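(* Let $s\in(\tfrac14,1]$ and $\tau,\omega>0$ be fixed. The minimization problem $$\Gamma_\omega:=\inf_{u\in\mathcal{Y}_\tau}\mathcal{B}_\omega(u)$$ has at least one solution, that is, there exists a complex-valued function $\Phi\in\mathcal{Y}_\tau$ such that $\mathcal{B}_\omega(\Phi)=\Gamma_\omega$. Moreover, $\Phi$ satisfies $$(-\Delta)^s\Phi+\omega\Phi-|\Phi|^2\Phi=0.$$
   Context: Functions are $2\pi$-periodic and complex-valued. $H^s_{per}$ is the space of periodic distributions $f$ with $\|f\|_{H^s_{per}}^2=2\pi\sum_{k\in\mathbb{Z}}(1+k^2)^s|\widehat f(k)|^2<\infty$, where $\widehat f(k)$ are the Fourier coefficients. The fractional Laplacian is $\widehat{(-\Delta)^sg}(k)=|k|^{2s}\widehat g(k)$, $k\in\mathbb{Z}$. The constraint set is $\mathcal{Y}_\tau=\{u\in H^s_{per}:\|u\|_{L^4_{per}}^4=\tau\}$, and $\mathcal{B}_\omega(u)=\frac12\int_{-\pi}^{\pi}|(-\Delta)^{\frac s2}u|^2+\omega|u|^2\,dx$ for $u\in H^s_{per}$.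
   Formalization: The equation is proved for sqrt(2Γ_ω/τ)·Φ instead of Φ, together with Γ_ω>0: pairing the equation with Φ forces 2Γ_ω=τ, which fails e.g. for ω=1, τ>2π; when 2Γ_ω=τ the factor is 1 and the original equation results. *)

theory Defs
  imports "HOL-Analysis.Analysis"
begin

definition fourier_coeff :: "(real \<Rightarrow> complex) \<Rightarrow> int \<Rightarrow> complex" where
  "fourier_coeff f k =
     (1 / (2 * pi)) *\<^sub>R (LINT x:{-pi..pi}|lborel. f x * exp (- \<i> * of_int k * of_real x))"

definition L2_per :: "(real \<Rightarrow> complex) set" where
  "L2_per = {f. (\<forall>x. f (x + 2 * pi) = f x) \<and> f \<in> borel_measurable borel \<and>
                set_integrable lborel {-pi..pi} (\<lambda>x. (norm (f x))\<^sup>2)}"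

(* Periodic distributions of finite H^s norm, for s >= 0 only: these are exactly the ones given by
   an L^2 function. Elements are representatives; functions equal a.e. are not identified. *)
definition H_per :: "real \<Rightarrow> (real \<Rightarrow> complex) set" where
  "H_per s = {f \<in> L2_per.
     (\<lambda>k::int. (1 + (real_of_int k)\<^sup>2) powr s * (norm (fourier_coeff f k))\<^sup>2) summable_on UNIV}"

(* Fourier coefficients of the periodic distribution (-Laplacian)^a g. They need not be those of a
   function: for g in H^s and a = s the distribution only lies in H^(-s).
   At k = 0 the factor is 0 powr (2 * a) = 0, as wanted for a > 0. *)
definition frac_laplacian_coeff :: "real \<Rightarrow> (real \<Rightarrow> complex) \<Rightarrow> int \<Rightarrow> complex" where
  "frac_laplacian_coeff a g k = of_real (\<bar>real_of_int k\<bar> powr (2 * a)) * fourier_coeff g k"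

(* (-Laplacian)^a g when it is an L^2 function, e.g. for g in H^s and a = s / 2. It exists then by
   Riesz-Fischer, and its coefficients determine it up to a null set. *)
definition frac_laplacian :: "real \<Rightarrow> (real \<Rightarrow> complex) \<Rightarrow> real \<Rightarrow> complex" where
  "frac_laplacian a g =
     (SOME h. h \<in> L2_per \<and> (\<forall>k. fourier_coeff h k = frac_laplacian_coeff a g k))"

definition constraint_set :: "real \<Rightarrow> real \<Rightarrow> (real \<Rightarrow> complex) set" where
  "constraint_set s \<tau> = {u \<in> H_per s.
     set_integrable lborel {-pi..pi} (\<lambda>x. (norm (u x)) ^ 4) \<and>
     (LINT x:{-pi..pi}|lborel. (norm (u x)) ^ 4) = \<tau>}"

definition energy :: "real \<Rightarrow> real \<Rightarrow> (real \<Rightarrow> complex) \<Rightarrow> real" where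
  "energy s \<omega> u = 1 / 2 * (LINT x:{-pi..pi}|lborel.
     (norm (frac_laplacian (s / 2) u x))\<^sup>2 + \<omega> * (norm (u x))\<^sup>2)"

definition min_energy :: "real \<Rightarrow> real \<Rightarrow> real \<Rightarrow> real" where
  "min_energy s \<omega> \<tau> = (INF u\<in>constraint_set s \<tau>. energy s \<omega> u)"

(* (-Laplacian)^s u + \<omega> u - |u|^2 u = 0 as an identity of periodic distributions, i.e. all Fourier
   coefficients of the left-hand side vanish. For u in L^4 the cubic term is integrable.
   A minimizer u at level \<tau> has Lagrange multiplier m = 2 * min_energy s \<omega> \<tau> / \<tau> in front of
   the cubic term (pair with u); m = 1 for a single \<tau> only, and in general sqrt m * u solves the
   equation with coefficient 1. *)
definition standing_wave_eq :: "real \<Rightarrow> real \<Rightarrow> (real \<Rightarrow> complex) \<Rightarrow> bool" where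
  "standing_wave_eq s \<omega> u \<longleftrightarrow>
     (\<forall>k. frac_laplacian_coeff s u k + of_real \<omega> * fourier_coeff u k
          - fourier_coeff (\<lambda>x. of_real ((norm (u x))\<^sup>2) * u x) k = 0)"

end

theory Submission
  imports Defs "HOL-Library.Diagonal_Subsequence"
begin

text \<open>
  Everything happens on the Fourier side. Writing \<open>c\<^sub>k\<close> for the Fourier coefficients of \<open>u\<close>, Parseval's
  identity gives the energy as \<open>\<pi> \<Sum> (|k|\<^sup>2\<^sup>s + \<omega>) |c\<^sub>k|\<^sup>2\<close>, which is equivalent to the squared norm of \<open>H\<^sup>s\<close>
  (\<open>has_sum_energy\<close>, \<open>sobolev_sq_le_energy\<close>).

  The constraint is controlled because the fourth power of the \<open>L\<^sup>4\<close> norm of \<open>u\<close> is the squared \<open>L\<^sup>2\<close> norm of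
  \<open>u\<^sup>2\<close>, whose coefficients are the convolution of \<open>c\<close> with itself. A weighted Cauchy--Schwarz inequality
  bounds the products of two functions in \<open>L\<^sup>2\<close> by their norms in \<open>H\<^sup>r\<close> as soon as
  \<open>\<Sum> (1 + k\<^sup>2)\<^sup>-\<^sup>2\<^sup>r\<close> is finite, that is for \<open>r > 1/4\<close> (\<open>product_estimate\<close>). This elementary route replaces
  the Hausdorff--Young inequality and interpolation. It needs two facts about Fourier series: the
  Riesz--Fischer theorem, and the uniqueness of Fourier coefficients for merely integrable functions,
  since the product of two \<open>L\<^sup>2\<close> functions is at first only known to be integrable.

  Since \<open>s > 1/4\<close>, there is room for an \<open>r\<close> with \<open>1/4 < r < s\<close>. A sequence bounded in \<open>H\<^sup>s\<close> with
  convergent coefficients converges in \<open>H\<^sup>r\<close>, so by the product estimate its \<open>L\<^sup>4\<close> norms converge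
  (\<open>compact_embedding_L4\<close>). The direct method then yields a minimizer (\<open>minimizer_exists\<close>).

  By scaling, the infimum \<open>\<Gamma>\<close> satisfies \<open>\<Gamma>\<^sup>2 \<parallel>u\<parallel>\<^sup>4 \<le> \<tau> B(u)\<^sup>2\<close> for all \<open>u\<close> in \<open>H\<^sup>s\<close>, with the \<open>L\<^sup>4\<close> norm on the
  left and the energy \<open>B\<close> on the right, and equality holds at a minimizer \<open>\<Phi>\<close>
  (\<open>homogeneous_energy_inequality\<close>). Inserting \<open>u = \<Phi> + t z e\<^sup>i\<^sup>k\<^sup>x\<close> gives a nonnegative polynomial in \<open>t\<close>
  that vanishes at \<open>t = 0\<close>; its linear coefficient is zero, and this is the Euler--Lagrange equation at
  frequency \<open>k\<close>, with Lagrange multiplier \<open>2 \<Gamma> / \<tau>\<close> (\<open>Euler_Lagrange\<close>). The factor in front of \<open>\<Phi>\<close>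
  normalizes this multiplier to one.
\<close>

section \<open>Fourier coefficients on the circle\<close>

text \<open>A finite measure in its own right, so that the integrals below carry no indicator functions.\<close>

definition circle :: "real measure" where
  "circle = restrict_space lborel {-pi..pi}"

definition character :: "int \<Rightarrow> real \<Rightarrow> complex" where
  "character k x = cis (of_int k * x)"

text \<open>Membership in \<open>L\<^sup>2\<close> of the circle. In contrast to \<^const>\<open>L2_per\<close>, nothing is asked outside
\<open>[-\<pi>, \<pi>]\<close>, so that the predicate can be transferred along equality almost everywhere.\<close>

definition square_integrable :: "(real \<Rightarrow> complex) \<Rightarrow> bool" where
  "square_integrable f \<longleftrightarrow> f \<in> borel_measurable circle \<and> integrable circle (\<lambda>x. (norm (f x))\<^sup>2)"

lemma space_circle: "space circle = {-pi..pi}"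
  by (simp add: circle_def space_restrict_space)

lemma finite_measure_circle: "finite_measure circle"
  unfolding circle_def by (rule finite_measureI) (simp add: emeasure_restrict_space space_restrict_space)

interpretation circle: finite_measure circle
  by (rule finite_measure_circle)

lemma measure_circle: "measure circle (space circle) = 2 * pi"
  unfolding circle_def by (simp add: measure_restrict_space space_restrict_space)

lemma borel_measurable_circle: "f \<in> borel_measurable borel \<Longrightarrow> f \<in> borel_measurable circle"
  unfolding circle_def by (intro measurable_restrict_space1) simp

lemma integrable_circle_iff:
  fixes f :: "real \<Rightarrow> 'a::{banach, second_countable_topology}"
  shows "set_integrable lborel {-pi..pi} f \<longleftrightarrow> integrable circle f"
  unfolding circle_def set_integrable_def by (simp add: integrable_restrict_space)

lemma integral_circle:
  fixes f :: "real \<Rightarrow> 'a::{banach, second_countable_topology}"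
  shows "(LINT x:{-pi..pi}|lborel. f x) = integral\<^sup>L circle f"
  unfolding circle_def set_lebesgue_integral_def by (simp add: integral_restrict_space)

lemma norm_character [simp]: "norm (character k x) = 1"
  by (simp add: character_def)

lemma character_0 [simp]: "character 0 x = 1"
  by (simp add: character_def)

lemma character_add: "character (k + l) x = character k x * character l x"
  by (simp add: character_def cis_mult algebra_simps)

lemma cnj_character: "cnj (character k x) = character (- k) x"
  by (simp add: character_def cis_cnj)

lemma character_periodic: "character k (x + 2 * pi) = character k x"
proof -
  have "character k (x + 2 * pi) = character k x * cis (2 * pi * of_int k)"
    by (simp add: character_def cis_mult algebra_simps)
  then show ?thesis by simp
qed

lemma character_measurable_borel [measurable]: "character k \<in> borel_measurable borel"
  unfolding character_def by (intro borel_measurable_continuous_onI continuous_intros)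

lemma character_measurable [measurable]: "character k \<in> borel_measurable circle"
  by (rule borel_measurable_circle) measurable

lemma integrable_mult_character:
  assumes "integrable circle f"
  shows "integrable circle (\<lambda>x. f x * character k x)"
proof (rule Bochner_Integration.integrable_bound[OF assms])
  show "(\<lambda>x. f x * character k x) \<in> borel_measurable circle"
    using assms by measurable
qed (simp add: norm_mult)

lemma integrable_character: "integrable circle (character k)"
  using integrable_mult_character[of "\<lambda>_. 1" k] by simp

lemma fourier_coeff_circle:
  "fourier_coeff f k = (1 / (2 * pi)) *\<^sub>R (\<integral>x. f x * character (- k) x \<partial>circle)"
proof -
  have "exp (- \<i> * of_int k * of_real x) = character (- k) x" for x
    by (simp add: character_def cis_conv_exp mult_ac)
  then show ?thesis
    unfolding fourier_coeff_def integral_circle by simp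
qed

lemma integral_circle_character:
  "(\<integral>x. f x * character (- k) x \<partial>circle) = of_real (2 * pi) * fourier_coeff f k"
  by (simp add: fourier_coeff_circle scaleR_conv_of_real)

lemma fourier_coeff_character: "fourier_coeff (character k) l = (if k = l then 1 else 0)"
proof -
  have *: "character k x * character (- l) x = character (k - l) x" for x
    using character_add[of k "- l" x] by simp
  have "integral\<^sup>L circle (character m) = 0" if "m \<noteq> 0" for m
  proof -
    let ?F = "\<lambda>x. character m x / (\<i> * of_int m)"
    have "integral\<^sup>L circle (character m) = (\<integral>x. indicator {-pi..pi} x *\<^sub>R character m x \<partial>lborel)"
      by (simp flip: integral_circle add: set_lebesgue_integral_def)
    also have "\<dots> = ?F pi - ?F (- pi)"
    proof (rule integral_FTC_Icc)
      show "(?F has_vector_derivative character m x) (at x within {-pi..pi})" for x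
        unfolding character_def using that
        by (auto intro!: derivative_eq_intros simp: has_vector_derivative_def scaleR_conv_of_real fun_eq_iff)
           (simp add: complex_eq_iff)
      show "continuous_on {-pi..pi} (character m)"
        unfolding character_def by (intro continuous_intros)
    qed simp
    also have "?F pi = ?F (- pi)"
      using character_periodic[of m "- pi"] by simp
    finally show ?thesis by simp
  qed
  moreover have "integral\<^sup>L circle (character 0) = of_real (2 * pi)"
  proof -
    have "integral\<^sup>L circle (character 0) = (\<integral>x. 1 \<partial>circle)"
      by (intro Bochner_Integration.integral_cong) auto
    then show ?thesis by (simp add: measure_circle scaleR_conv_of_real)
  qed
  ultimately show ?thesis
    unfolding fourier_coeff_circle * by (simp add: scaleR_conv_of_real)
qed

lemma fourier_coeff_add:
  assumes "integrable circle f" "integrable circle g"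
  shows "fourier_coeff (\<lambda>x. f x + g x) k = fourier_coeff f k + fourier_coeff g k"
  using integrable_mult_character[OF assms(1)] integrable_mult_character[OF assms(2)]
  by (simp add: fourier_coeff_circle algebra_simps)

lemma fourier_coeff_diff:
  assumes "integrable circle f" "integrable circle g"
  shows "fourier_coeff (\<lambda>x. f x - g x) k = fourier_coeff f k - fourier_coeff g k"
  using integrable_mult_character[OF assms(1)] integrable_mult_character[OF assms(2)]
  by (simp add: fourier_coeff_circle algebra_simps)

lemma fourier_coeff_cmult: "fourier_coeff (\<lambda>x. a * f x) k = a * fourier_coeff f k"
  by (simp add: fourier_coeff_circle mult.assoc scaleR_conv_of_real)

lemma fourier_coeff_mult_character: 
  "fourier_coeff (\<lambda>x. f x * character m x) k = fourier_coeff f (k - m)"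
  using character_add[of m "- k"] by (simp add: fourier_coeff_circle mult.assoc)

lemma fourier_coeff_cnj: "fourier_coeff (\<lambda>x. cnj (f x)) k = cnj (fourier_coeff f (- k))"
proof -
  have "(\<integral>x. cnj (f x) * character (- k) x \<partial>circle) = (\<integral>x. cnj (f x * character k x) \<partial>circle)"
    by (simp add: cnj_character)
  also have "\<dots> = cnj (\<integral>x. f x * character k x \<partial>circle)"
    by (rule Bochner_Integration.integral_cnj)
  finally show ?thesis by (simp add: fourier_coeff_circle)
qed

lemma fourier_coeff_sum:
  assumes "\<And>k. k \<in> F \<Longrightarrow> integrable circle (f k)"
  shows "fourier_coeff (\<lambda>x. \<Sum>k\<in>F. f k x) l = (\<Sum>k\<in>F. fourier_coeff (f k) l)"
proof -
  have "(\<integral>x. (\<Sum>k\<in>F. f k x) * character (- l) x \<partial>circle)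
      = (\<Sum>k\<in>F. \<integral>x. f k x * character (- l) x \<partial>circle)"
    unfolding sum_distrib_right
    by (intro Bochner_Integration.integral_sum integrable_mult_character assms)
  then show ?thesis by (simp add: fourier_coeff_circle scaleR_sum_right)
qed

lemma integrable_mult_square_integrable:
  assumes "square_integrable f" "square_integrable g"
  shows "integrable circle (\<lambda>x. f x * g x)"
proof (rule Bochner_Integration.integrable_bound)
  show "integrable circle (\<lambda>x. (norm (f x))\<^sup>2 + (norm (g x))\<^sup>2)"
    using assms unfolding square_integrable_def by auto
  show "(\<lambda>x. f x * g x) \<in> borel_measurable circle"
    using assms unfolding square_integrable_def by auto
  have "norm (f x * g x) \<le> (norm (f x))\<^sup>2 + (norm (g x))\<^sup>2" for x
    using sum_squares_bound[of "norm (f x)" "norm (g x)"] zero_le_power2[of "norm (f x)"] zero_le_power2[of "norm (g x)"]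
    unfolding norm_mult by linarith
  then show "AE x in circle. norm (f x * g x) \<le> norm ((norm (f x))\<^sup>2 + (norm (g x))\<^sup>2)"
    by (auto intro: order_trans)
qed

lemma square_integrable_character: "square_integrable (character k)"
  by (simp add: square_integrable_def)

lemma square_integrable_one: "square_integrable (\<lambda>_. 1)"
  by (simp add: square_integrable_def)

lemma square_integrable_imp_integrable: "square_integrable f \<Longrightarrow> integrable circle f"
  using integrable_mult_square_integrable[OF _ square_integrable_one] by simp

lemma borel_measurable_cnj: "f \<in> borel_measurable M \<Longrightarrow> (\<lambda>x. cnj (f x)) \<in> borel_measurable M"
  by (rule borel_measurable_continuous_on[of cnj]) (intro continuous_intros)

lemma square_integrable_cnj: "square_integrable f \<Longrightarrow> square_integrable (\<lambda>x. cnj (f x))"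
  by (auto simp: square_integrable_def intro: borel_measurable_cnj)

lemma square_integrable_cmult: "square_integrable f \<Longrightarrow> square_integrable (\<lambda>x. a * f x)"
  by (auto simp: square_integrable_def norm_mult power_mult_distrib)

lemma square_integrable_mult_character:
  "square_integrable f \<Longrightarrow> square_integrable (\<lambda>x. f x * character k x)"
  by (auto simp: square_integrable_def norm_mult)

lemma norm_add_sq_complex: 
  "(norm (z + w :: complex))\<^sup>2 = (norm z)\<^sup>2 + 2 * Re (z * cnj w) + (norm w)\<^sup>2"
  by (simp only: cmod_power2) (simp add: power2_eq_square algebra_simps)

lemma norm_diff_sq_complex: 
  "(norm (z - w :: complex))\<^sup>2 = (norm z)\<^sup>2 - 2 * Re (z * cnj w) + (norm w)\<^sup>2"
  by (simp only: cmod_power2) (simp add: power2_eq_square algebra_simps)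

lemma square_integrable_add:
  assumes "square_integrable f" "square_integrable g"
  shows "square_integrable (\<lambda>x. f x + g x)"
proof -
  have "integrable circle (\<lambda>x. (norm (f x))\<^sup>2 + 2 * Re (f x * cnj (g x)) + (norm (g x))\<^sup>2)"
    using assms integrable_mult_square_integrable[OF assms(1) square_integrable_cnj[OF assms(2)]]
    unfolding square_integrable_def
    by (intro Bochner_Integration.integrable_add integrable_mult_right integrable_Re) auto
  then show ?thesis using assms unfolding square_integrable_def norm_add_sq_complex by auto
qed

lemma square_integrable_diff:
  assumes "square_integrable f" "square_integrable g"
  shows "square_integrable (\<lambda>x. f x - g x)"
  using square_integrable_add[OF assms(1) square_integrable_cmult[OF assms(2), of "-1"]] by simp

lemma square_integrable_sum:
  assumes "\<And>k. k \<in> F \<Longrightarrow> square_integrable (f k)"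
  shows "square_integrable (\<lambda>x. \<Sum>k\<in>F. f k x)"
  using assms
proof (induction F rule: infinite_finite_induct)
  case (insert k F)
  then show ?case by (simp add: square_integrable_add)
qed (auto simp: square_integrable_def)

lemma integral_norm_diff_sq:
  assumes "square_integrable f" "square_integrable g"
  shows "(\<integral>x. (norm (f x - g x))\<^sup>2 \<partial>circle) = (\<integral>x. (norm (f x))\<^sup>2 \<partial>circle)
     - 2 * Re (\<integral>x. f x * cnj (g x) \<partial>circle) + (\<integral>x. (norm (g x))\<^sup>2 \<partial>circle)"
proof -
  have *: "integrable circle (\<lambda>x. (norm (f x))\<^sup>2)" "integrable circle (\<lambda>x. (norm (g x))\<^sup>2)"
    "integrable circle (\<lambda>x. f x * cnj (g x))"
    using assms integrable_mult_square_integrable[OF assms(1) square_integrable_cnj[OF assms(2)]]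
    by (auto simp: square_integrable_def)
  then have "integrable circle (\<lambda>x. Re (f x * cnj (g x)))"
    by (intro integrable_Re)
  with * show ?thesis
    unfolding norm_diff_sq_complex integral_Re[OF *(3), symmetric]
    by (simp only: Bochner_Integration.integral_add Bochner_Integration.integral_diff integrable_mult_right 
         Bochner_Integration.integrable_diff integral_mult_right_zero)
qed

definition trig_sum :: "int set \<Rightarrow> (int \<Rightarrow> complex) \<Rightarrow> real \<Rightarrow> complex" where
  "trig_sum F c x = (\<Sum>k\<in>F. c k * character k x)"

lemma trig_sum_measurable [measurable]: "trig_sum F c \<in> borel_measurable borel"
  unfolding trig_sum_def by measurable

lemma trig_sum_measurable_circle [measurable]: "trig_sum F c \<in> borel_measurable circle"
  by (rule borel_measurable_circle) measurable

lemma square_integrable_trig_sum: "square_integrable (trig_sum F c)"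
  unfolding trig_sum_def
  by (intro square_integrable_sum square_integrable_cmult square_integrable_character)

lemma fourier_coeff_trig_sum:
  assumes "finite F"
  shows "fourier_coeff (trig_sum F c) l = (if l \<in> F then c l else 0)"
proof -
  have "fourier_coeff (trig_sum F c) l = (\<Sum>k\<in>F. c k * (if k = l then 1 else 0))"
    unfolding trig_sum_def 
    by (subst fourier_coeff_sum)
       (auto intro!: sum.cong simp: fourier_coeff_cmult fourier_coeff_character integrable_character)
  then show ?thesis using assms by (simp add: if_distrib[of "(*) _"] cong: if_cong)
qed

lemma integral_mult_cnj_trig_sum:
  assumes "square_integrable f" "finite F"
  shows "(\<integral>x. f x * cnj (trig_sum F c x) \<partial>circle) = of_real (2 * pi) * (\<Sum>k\<in>F. fourier_coeff f k * cnj (c k))"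
proof -
  have "(\<integral>x. f x * cnj (trig_sum F c x) \<partial>circle) = (\<integral>x. (\<Sum>k\<in>F. cnj (c k) * (f x * character (- k) x)) \<partial>circle)"
    by (simp add: trig_sum_def sum_distrib_left cnj_character mult_ac)
  also have "\<dots> = (\<Sum>k\<in>F. cnj (c k) * (\<integral>x. f x * character (- k) x \<partial>circle))"
    by (subst Bochner_Integration.integral_sum)
       (auto intro!: integrable_mult_right integrable_mult_character square_integrable_imp_integrable[OF assms(1)])
  finally show ?thesis unfolding integral_circle_character by (simp add: sum_distrib_left mult_ac)
qed

lemma integral_norm_trig_sum:
  assumes "finite F"
  shows "(\<integral>x. (norm (trig_sum F c x))\<^sup>2 \<partial>circle) = 2 * pi * (\<Sum>k\<in>F. (norm (c k))\<^sup>2)"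
proof -
  have "complex_of_real (\<integral>x. (norm (trig_sum F c x))\<^sup>2 \<partial>circle) 
     = (\<integral>x. trig_sum F c x * cnj (trig_sum F c x) \<partial>circle)"
    by (simp only: complex_norm_square flip: integral_complex_of_real)
  also have "\<dots> = of_real (2 * pi) * (\<Sum>k\<in>F. c k * cnj (c k))"
    using assms by (subst integral_mult_cnj_trig_sum)
       (auto simp: square_integrable_trig_sum fourier_coeff_trig_sum)
  also have "\<dots> = of_real (2 * pi * (\<Sum>k\<in>F. (norm (c k))\<^sup>2))"
    by (simp only: of_real_sum of_real_mult complex_norm_square)
  finally show ?thesis using of_real_eq_iff by blast
qed

text \<open>The defect in Bessel's inequality is the squared distance to the partial Fourier sum. Both Bessel's
inequality and the norm identity in the Riesz--Fischer theorem are read off from it.\<close>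

lemma integral_norm_diff_trig_sum:
  assumes "square_integrable f" "finite F"
  shows "(\<integral>x. (norm (f x - trig_sum F (fourier_coeff f) x))\<^sup>2 \<partial>circle)
     = (\<integral>x. (norm (f x))\<^sup>2 \<partial>circle) - 2 * pi * (\<Sum>k\<in>F. (norm (fourier_coeff f k))\<^sup>2)"
proof -
  have "(\<Sum>k\<in>F. fourier_coeff f k * cnj (fourier_coeff f k)) = of_real (\<Sum>k\<in>F. (norm (fourier_coeff f k))\<^sup>2)"
    by (simp only: of_real_sum complex_norm_square)
  then show ?thesis
    by (simp add: integral_norm_diff_sq[OF assms(1) square_integrable_trig_sum]
          integral_mult_cnj_trig_sum[OF assms] integral_norm_trig_sum[OF assms(2)])
qed

lemma Bessel_inequality:
  assumes "square_integrable f" "finite F"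
  shows "2 * pi * (\<Sum>k\<in>F. (norm (fourier_coeff f k))\<^sup>2) \<le> (\<integral>x. (norm (f x))\<^sup>2 \<partial>circle)"
  using integral_norm_diff_trig_sum[OF assms] 
    Bochner_Integration.integral_nonneg[of circle "\<lambda>x. (norm (f x - trig_sum F (fourier_coeff f) x))\<^sup>2"]
  by simp

lemma summable_fourier_coeff_sq:
  assumes "square_integrable f"
  shows "(\<lambda>k. (norm (fourier_coeff f k))\<^sup>2) summable_on UNIV"
proof (rule nonneg_bounded_partial_sums_imp_summable_on)
  show "\<forall>\<^sub>F F in finite_subsets_at_top UNIV.
      (\<Sum>k\<in>F. (norm (fourier_coeff f k))\<^sup>2) \<le> (\<integral>x. (norm (f x))\<^sup>2 \<partial>circle) / (2 * pi)"
  proof (rule eventually_finite_subsets_at_top_weakI)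
    fix F :: "int set" assume "finite F"
    from Bessel_inequality[OF assms this] 
    show "(\<Sum>k\<in>F. (norm (fourier_coeff f k))\<^sup>2) \<le> (\<integral>x. (norm (f x))\<^sup>2 \<partial>circle) / (2 * pi)"
      by (simp add: field_simps)
  qed
qed simp

section \<open>The Riesz--Fischer theorem\<close>

text \<open>Fatou's lemma for squared norms. A bound on a tail of the sequence is enough; this form lets
the starting index of a partial sum be kept fixed while the other index tends to infinity.\<close>

lemma integral_norm_sq_le_of_AE_limit:
  assumes lim: "AE x in circle. (\<lambda>j. g j x) \<longlonglongrightarrow> (h x :: complex)"
    and h: "h \<in> borel_measurable circle" and g: "\<And>j. square_integrable (g j)"
    and bound: "\<forall>\<^sub>F j in sequentially. (\<integral>x. (norm (g j x))\<^sup>2 \<partial>circle) \<le> B"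
  shows "square_integrable h" "(\<integral>x. (norm (h x))\<^sup>2 \<partial>circle) \<le> B"
proof -
  note [measurable] = h
  have [measurable]: "g j \<in> borel_measurable circle" for j
    using g by (simp add: square_integrable_def)
  have gB: "(\<integral>\<^sup>+x. ennreal ((norm (g j x))\<^sup>2) \<partial>circle) = ennreal (\<integral>x. (norm (g j x))\<^sup>2 \<partial>circle)" for j
    using g[of j] unfolding square_integrable_def by (intro nn_integral_eq_integral) auto
  obtain j where "(\<integral>x. (norm (g j x))\<^sup>2 \<partial>circle) \<le> B"
    using bound by (auto simp: eventually_sequentially)
  then have B0: "B \<ge> 0"
    by (rule order_trans[rotated]) simp
  \<comment> \<open>Almost everywhere, the limit inferior of the integrands is the limit, and Fatou applies.\<close>
  have "(\<integral>\<^sup>+x. ennreal ((norm (h x))\<^sup>2) \<partial>circle) 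
      = (\<integral>\<^sup>+x. liminf (\<lambda>j. ennreal ((norm (g j x))\<^sup>2)) \<partial>circle)"
  proof (rule nn_integral_cong_AE)
    show "AE x in circle. ennreal ((norm (h x))\<^sup>2) = liminf (\<lambda>j. ennreal ((norm (g j x))\<^sup>2))"
      using lim
    proof eventually_elim
      case (elim x)
      then have "(\<lambda>j. ennreal ((norm (g j x))\<^sup>2)) \<longlonglongrightarrow> ennreal ((norm (h x))\<^sup>2)"
        by (intro tendsto_intros)
      from lim_imp_Liminf[OF _ this] show ?case by simp
    qed
  qed
  also have "\<dots> \<le> liminf (\<lambda>j. \<integral>\<^sup>+x. ennreal ((norm (g j x))\<^sup>2) \<partial>circle)"
    by (rule nn_integral_liminf) measurable
  also have "\<dots> \<le> liminf (\<lambda>j::nat. ennreal B)"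
    unfolding gB using bound by (intro Liminf_mono) (auto elim!: eventually_mono intro: ennreal_leI)
  also have "\<dots> = ennreal B"
    by (simp add: Liminf_const)
  finally have *: "(\<integral>\<^sup>+x. ennreal ((norm (h x))\<^sup>2) \<partial>circle) \<le> ennreal B" .
  then have "integrable circle (\<lambda>x. (norm (h x))\<^sup>2)"
    by (intro integrableI_bounded) (auto intro: le_less_trans)
  then show "square_integrable h"
    by (simp add: square_integrable_def h)
  have "ennreal (\<integral>x. (norm (h x))\<^sup>2 \<partial>circle) \<le> ennreal B"
    using * \<open>integrable circle (\<lambda>x. (norm (h x))\<^sup>2)\<close> by (subst (asm) nn_integral_eq_integral) auto
  then show "(\<integral>x. (norm (h x))\<^sup>2 \<partial>circle) \<le> B"
    using B0 by (simp add: ennreal_le_iff)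
qed

lemma filterlim_symmetric_box: 
  "filterlim (\<lambda>n. {- int n..int n}) (finite_subsets_at_top UNIV) sequentially"
  unfolding filterlim_finite_subsets_at_top
proof (intro allI impI)
  fix X :: "int set" assume X: "finite X \<and> X \<subseteq> UNIV"
  have "X \<subseteq> {- int n..int n}" if "n \<ge> (\<Sum>x\<in>X. nat \<bar>x\<bar>)" for n
  proof
    fix x assume "x \<in> X"
    then have "nat \<bar>x\<bar> \<le> (\<Sum>x\<in>X. nat \<bar>x\<bar>)"
      using X by (intro member_le_sum) auto
    then have "nat \<bar>x\<bar> \<le> n" using that by linarith
    then show "x \<in> {- int n..int n}" by auto
  qed
  then show "\<forall>\<^sub>F n in sequentially. finite {- int n..int n} \<and> X \<subseteq> {- int n..int n} \<and> {- int n..int n} \<subseteq> UNIV"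
    unfolding eventually_sequentially by blast
qed

text \<open>Since the terms of the series tend to zero, the increments are eventually at most \<open>2\<^sup>-\<^sup>j\<close> and are
therefore summable.\<close>

lemma convergent_of_geometric_increments:
  fixes G :: "nat \<Rightarrow> complex"
  assumes "summable (\<lambda>j. 4 ^ j * (norm (G (Suc j) - G j))\<^sup>2)"
  shows "convergent G"
proof -
  have "\<forall>\<^sub>F j in sequentially. 4 ^ j * (norm (G (Suc j) - G j))\<^sup>2 < 1"
    using summable_LIMSEQ_zero[OF assms] by (rule order_tendstoD) simp
  then have ev: "\<forall>\<^sub>F j in sequentially. norm (G (Suc j) - G j) \<le> (1 / 2) ^ j"
  proof eventually_elim
    case (elim j)
    have "(2 ^ j * norm (G (Suc j) - G j))\<^sup>2 = 4 ^ j * (norm (G (Suc j) - G j))\<^sup>2"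
      by (simp add: power2_eq_square flip: power_mult_distrib)
    with elim have "(2 ^ j * norm (G (Suc j) - G j))\<^sup>2 \<le> 1\<^sup>2" by simp
    then have "2 ^ j * norm (G (Suc j) - G j) \<le> 1"
      by (rule power2_le_imp_le) simp
    then show ?case by (simp add: power_divide field_simps)
  qed
  have "summable (\<lambda>j. G (Suc j) - G j)"
    by (rule summable_comparison_test_ev[OF ev]) (simp add: summable_geometric)
  then have "convergent (\<lambda>n. \<Sum>j<n. G (Suc j) - G j)"
    by (simp add: summable_iff_convergent)
  then have "convergent (\<lambda>n. G n - G 0)"
    by (simp add: sum_lessThan_telescope)
  then show ?thesis
    by (simp add: convergent_diff_const_right_iff)
qed

text \<open>Partial sums along a sufficiently sparse sequence of frequency boxes converge almost everywhere:
if the tail beyond the \<open>j\<close>-th box has square sum at most \<open>8\<^sup>-\<^sup>j\<close>, then the squared increments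
weighted by \<open>4\<^sup>j\<close> have a finite total integral, so that the increments are eventually bounded by
\<open>2\<^sup>-\<^sup>j\<close> at almost every point. Fatou's lemma bounds the distance of the limit to the partial sums, and
this gives the coefficients and the norm of the limit. Because trigonometric sums are periodic on the
whole line, so is their pointwise limit.\<close>

lemma Riesz_Fischer:
  fixes c :: "int \<Rightarrow> complex"
  assumes c: "(\<lambda>k. (norm (c k))\<^sup>2) summable_on UNIV"
  obtains h where "h \<in> L2_per" "square_integrable h" "\<And>k. fourier_coeff h k = c k"
    "((\<lambda>k. (norm (c k))\<^sup>2) has_sum ((\<integral>x. (norm (h x))\<^sup>2 \<partial>circle) / (2 * pi))) UNIV"
proof -
  define a where "a = (\<lambda>k. (norm (c k))\<^sup>2)"
  define S where "S = infsum a UNIV"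
  define box where "box = (\<lambda>n::nat. {- int n..int n})"
  have a: "a summable_on UNIV" "\<And>k. a k \<ge> 0" using c by (auto simp: a_def)
  have aS: "(a has_sum S) UNIV" unfolding S_def using a(1) by (rule has_sum_infsum)
  have le_S: "sum a F \<le> S" if "finite F" for F
    unfolding S_def using that a by (intro finite_sum_le_infsum) auto
  have box_lim: "(\<lambda>n. sum a (box n)) \<longlonglongrightarrow> S"
    using aS filterlim_symmetric_box unfolding has_sum_def box_def by (rule filterlim_compose)
  have "\<exists>n. S - sum a (box n) \<le> (1 / 8) ^ j" for j :: nat
  proof -
    have "\<forall>\<^sub>F n in sequentially. S - (1 / 8) ^ j < sum a (box n)"
      by (rule order_tendstoD(1)[OF box_lim]) simp
    then show ?thesis by (auto simp: eventually_sequentially) (smt (verit) order_refl)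
  qed
  then obtain n0 where n0: "\<And>j. S - sum a (box (n0 j)) \<le> (1 / 8) ^ j" by metis
  \<comment> \<open>The sum makes the boxes increasing, and the successor makes them exhaust all frequencies.\<close>
  define N where "N = (\<lambda>j. \<Sum>i\<le>j. Suc (n0 i))"
  define F where "F = (\<lambda>j. box (N j))"
  have box_mono: "box m \<subseteq> box n" if "m \<le> n" for m n
    using that by (auto simp: box_def)
  have finF: "finite (F j)" for j by (simp add: F_def box_def)
  have monoF: "F i \<subseteq> F j" if "i \<le> j" for i j
    unfolding F_def N_def using that by (intro box_mono sum_mono2) auto
  have exhF: "k \<in> F j" if "j \<ge> nat \<bar>k\<bar>" for j k
  proof -
    have "j \<le> (\<Sum>i\<le>j. 1)" by simp
    also have "\<dots> \<le> N j" unfolding N_def by (intro sum_mono) auto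
    finally show ?thesis using that by (auto simp: F_def box_def)
  qed
  have tailF: "S - sum a (F j) \<le> (1 / 8) ^ j" for j
  proof -
    have "n0 j \<le> N j"
      using member_le_sum[of j "{..j}" "\<lambda>i. Suc (n0 i)"] by (simp add: N_def)
    then have "box (n0 j) \<subseteq> F j" unfolding F_def by (rule box_mono)
    then have "sum a (box (n0 j)) \<le> sum a (F j)" using finF a by (intro sum_mono2) auto
    with n0[of j] show ?thesis by linarith
  qed
  define G where "G = (\<lambda>j. trig_sum (F j) c)"
  have G_diff: "G j x - G i x = trig_sum (F j - F i) c x" if "i \<le> j" for i j x
    using monoF[OF that] finF unfolding G_def trig_sum_def by (subst sum_diff) auto
  have G_bound: "(\<integral>x. (norm (G j x - G i x))\<^sup>2 \<partial>circle) \<le> 2 * pi * (1 / 8) ^ i" if "i \<le> j" for i j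
  proof -
    have "(\<integral>x. (norm (G j x - G i x))\<^sup>2 \<partial>circle) = 2 * pi * sum a (F j - F i)"
      unfolding G_diff[OF that] using finF by (subst integral_norm_trig_sum) (auto simp: a_def)
    also have "sum a (F j - F i) = sum a (F j) - sum a (F i)"
      using monoF[OF that] finF by (intro sum_diff) auto
    also have "\<dots> \<le> (1 / 8) ^ i"
      using le_S[OF finF[of j]] tailF[of i] by linarith
    finally show ?thesis by simp
  qed
  have sqG: "square_integrable (G j)" for j
    unfolding G_def by (rule square_integrable_trig_sum)
  have [measurable]: "G j \<in> borel_measurable borel" "G j \<in> borel_measurable circle" for j
    unfolding G_def by measurable
  define D where "D = (\<lambda>j x. 4 ^ j * (norm (G (Suc j) x - G j x))\<^sup>2)"
  have [measurable]: "D j \<in> borel_measurable circle" for j unfolding D_def by measurable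
  have D0: "D j x \<ge> 0" for j x by (simp add: D_def)
  have "(\<integral>\<^sup>+x. (\<Sum>j. ennreal (D j x)) \<partial>circle) = (\<Sum>j. \<integral>\<^sup>+x. ennreal (D j x) \<partial>circle)"
    by (rule nn_integral_suminf) measurable
  also have "\<dots> \<le> (\<Sum>j. ennreal (2 * pi * (1 / 2) ^ j))"
  proof (intro suminf_le)
    fix j
    have int: "integrable circle (D j)"
      using square_integrable_diff[OF sqG sqG, of "Suc j" j] 
      unfolding D_def square_integrable_def by (intro integrable_mult_right) auto
    have "integral\<^sup>L circle (D j) = 4 ^ j * (\<integral>x. (norm (G (Suc j) x - G j x))\<^sup>2 \<partial>circle)"
      unfolding D_def by simp
    also have "\<dots> \<le> 4 ^ j * (2 * pi * (1 / 8) ^ j)"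
      by (intro mult_left_mono G_bound) auto
    also have "\<dots> = 2 * pi * ((4 * (1 / 8)) ^ j)"
      unfolding power_mult_distrib by simp
    finally have "integral\<^sup>L circle (D j) \<le> 2 * pi * (1 / 2) ^ j" by simp
    then show "(\<integral>\<^sup>+x. ennreal (D j x) \<partial>circle) \<le> ennreal (2 * pi * (1 / 2) ^ j)"
      using int D0 by (subst nn_integral_eq_integral) (auto intro: ennreal_leI)
  qed auto
  also have "\<dots> = ennreal (\<Sum>j. 2 * pi * (1 / 2) ^ j)"
    by (intro suminf_ennreal2 summable_mult) (auto simp: summable_geometric)
  also have "\<dots> < \<infinity>" by simp
  finally have "AE x in circle. (\<Sum>j. ennreal (D j x)) \<noteq> \<infinity>"
    by (intro nn_integral_PInf_AE) auto
  then have convG: "AE x in circle. convergent (\<lambda>j. G j x)"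
  proof eventually_elim
    case (elim x)
    then have "summable (\<lambda>j. D j x)" using D0 by (intro summable_suminf_not_top) auto
    then show ?case unfolding D_def by (rule convergent_of_geometric_increments)
  qed
  \<comment> \<open>Where the partial sums diverge, \<^const>\<open>lim\<close> has an arbitrary but still periodic value.\<close>
  define h where "h = (\<lambda>x. lim (\<lambda>j. G j x))"
  have hmeas: "h \<in> borel_measurable borel" unfolding h_def by measurable
  then have [measurable]: "h \<in> borel_measurable circle" by (rule borel_measurable_circle)
  have per: "h (x + 2 * pi) = h x" for x
    by (simp add: h_def G_def trig_sum_def character_periodic)
  have limG: "AE x in circle. (\<lambda>j. G j x) \<longlonglongrightarrow> h x"
    using convG by eventually_elim (simp add: h_def convergent_LIMSEQ_iff)
  have hG: "square_integrable (\<lambda>x. h x - G i x)" 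
    "(\<integral>x. (norm (h x - G i x))\<^sup>2 \<partial>circle) \<le> 2 * pi * (1 / 8) ^ i" for i
  proof -
    have *: "AE x in circle. (\<lambda>j. G j x - G i x) \<longlonglongrightarrow> h x - G i x"
      using limG by eventually_elim (intro tendsto_intros)
    have ev: "\<forall>\<^sub>F j in sequentially. (\<integral>x. (norm (G j x - G i x))\<^sup>2 \<partial>circle) \<le> 2 * pi * (1 / 8) ^ i"
      using eventually_ge_at_top[of i] by eventually_elim (rule G_bound)
    show "square_integrable (\<lambda>x. h x - G i x)" 
      "(\<integral>x. (norm (h x - G i x))\<^sup>2 \<partial>circle) \<le> 2 * pi * (1 / 8) ^ i"
      using integral_norm_sq_le_of_AE_limit[OF * _ square_integrable_diff[OF sqG sqG] ev] by auto
  qed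
  have sqh: "square_integrable h"
    using square_integrable_add[OF hG(1) sqG, of 0 0] by simp
  have coeff: "fourier_coeff h k = c k" for k
  proof -
    have "(norm (fourier_coeff h k - c k))\<^sup>2 \<le> (1 / 8) ^ i" if "i \<ge> nat \<bar>k\<bar>" for i
    proof -
      have "fourier_coeff (\<lambda>x. h x - G i x) k = fourier_coeff h k - c k"
        using exhF[OF that] finF
        by (subst fourier_coeff_diff) 
           (auto intro!: square_integrable_imp_integrable sqh square_integrable_trig_sum
            simp: G_def fourier_coeff_trig_sum)
      then have "2 * pi * (norm (fourier_coeff h k - c k))\<^sup>2 \<le> 2 * pi * (1 / 8) ^ i"
        using order_trans[OF Bessel_inequality[OF hG(1), of "{k}" i] hG(2)[of i]] by simp
      then show ?thesis by simp
    qed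
    then have "(norm (fourier_coeff h k - c k))\<^sup>2 \<le> 0"
      by (intro LIMSEQ_le_const[of "\<lambda>i. (1 / 8 :: real) ^ i"] LIMSEQ_power_zero) auto
    then show ?thesis by simp
  qed
  have "(\<integral>x. (norm (h x))\<^sup>2 \<partial>circle) = 2 * pi * S"
  proof -
    have *: "(\<integral>x. (norm (h x - G i x))\<^sup>2 \<partial>circle) = (\<integral>x. (norm (h x))\<^sup>2 \<partial>circle) - 2 * pi * sum a (F i)" for i
    proof -
      have "fourier_coeff h = c" using coeff by (rule ext)
      then show ?thesis using integral_norm_diff_trig_sum[OF sqh finF[of i]] by (simp add: a_def G_def)
    qed
    have "\<bar>(\<integral>x. (norm (h x))\<^sup>2 \<partial>circle) - 2 * pi * S\<bar> \<le> 2 * pi * (1 / 8) ^ i" for i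
    proof -
      have "2 * pi * sum a (F i) \<le> 2 * pi * S" "2 * pi * (S - sum a (F i)) \<le> 2 * pi * (1 / 8) ^ i"
        using le_S[OF finF[of i]] tailF[of i] by (intro mult_left_mono; simp)+
      moreover have "0 \<le> (\<integral>x. (norm (h x - G i x))\<^sup>2 \<partial>circle)" by simp
      ultimately show ?thesis
        using hG(2)[of i] *[of i] unfolding right_diff_distrib abs_le_iff by linarith
    qed
    then have "\<bar>(\<integral>x. (norm (h x))\<^sup>2 \<partial>circle) - 2 * pi * S\<bar> \<le> 2 * pi * 0"
      by (intro LIMSEQ_le_const[of "\<lambda>i. 2 * pi * (1 / 8 :: real) ^ i"] tendsto_mult_left LIMSEQ_power_zero) auto
    then show ?thesis by simp
  qed
  then have "((\<lambda>k. (norm (c k))\<^sup>2) has_sum ((\<integral>x. (norm (h x))\<^sup>2 \<partial>circle) / (2 * pi))) UNIV"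
    using aS unfolding a_def by simp
  moreover have "h \<in> L2_per"
    using per hmeas sqh unfolding L2_per_def integrable_circle_iff square_integrable_def by blast
  ultimately show thesis
    using that sqh coeff by blast
qed

section \<open>Uniqueness of Fourier coefficients of integrable functions\<close>

lemma cis_measurable_circle [measurable]: "cis \<in> borel_measurable circle"
  by (intro borel_measurable_circle borel_measurable_continuous_onI continuous_intros)

text \<open>The property of having all Fourier coefficients zero survives multiplication by \<open>e\<^sup>i\<^sup>x\<close> and
\<open>e\<^sup>-\<^sup>i\<^sup>x\<close>, hence by any real-linear function of \<^term>\<open>cis x\<close>. Stating the conclusion as the same
property of the product, for all \<open>f\<close> at once, makes the case of a product of polynomials two
applications of the induction hypothesis.\<close>

lemma vanishing_coeffs_mult_polynomial:
  assumes "real_polynomial_function p" "integrable circle f" "\<And>k. fourier_coeff f k = 0"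
  shows "integrable circle (\<lambda>x. f x * of_real (p (cis x))) \<and>
         (\<forall>k. fourier_coeff (\<lambda>x. f x * of_real (p (cis x))) k = 0)"
  using assms
proof (induction p arbitrary: f rule: real_polynomial_function.induct)
  case (linear p)
  interpret bounded_linear p by fact
  define A B where "A = (of_real (p 1) - \<i> * of_real (p \<i>)) / 2" and "B = (of_real (p 1) + \<i> * of_real (p \<i>)) / 2"
  have p_cis: "complex_of_real (p (cis x)) = A * character 1 x + B * character (- 1) x" for x
  proof -
    have "cis x = cos x *\<^sub>R 1 + sin x *\<^sub>R \<i>" by (simp add: complex_eq_iff)
    then have "p (cis x) = cos x * p 1 + sin x * p \<i>" by (simp only: add scaleR) simp
    then show ?thesis by (simp add: A_def B_def character_def complex_eq_iff field_simps)
  qed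
  have *: "f x * of_real (p (cis x)) = A * (f x * character 1 x) + B * (f x * character (- 1) x)" for x
    unfolding p_cis by (simp add: algebra_simps)
  have int: "integrable circle (\<lambda>x. C * (f x * character m x))" for C m
    by (intro integrable_mult_right integrable_mult_character linear.prems(1))
  show ?case
    unfolding * using linear.prems
    by (auto intro!: Bochner_Integration.integrable_add int
        simp: fourier_coeff_add[OF int int] fourier_coeff_cmult fourier_coeff_mult_character)
next
  case (const c)
  then show ?case by (simp add: mult.commute[of "f _"] fourier_coeff_cmult)
next
  case (add p q)
  then show ?case by (auto simp: ring_distribs fourier_coeff_add)
next
  case (mult p q)
  have "integrable circle (\<lambda>x. f x * of_real (p (cis x)) * of_real (q (cis x))) \<and>
         (\<forall>k. fourier_coeff (\<lambda>x. f x * of_real (p (cis x)) * of_real (q (cis x))) k = 0)"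
    using mult.IH(1)[OF mult.prems] by (intro mult.IH(2)) auto
  then show ?case by (simp add: mult.assoc)
qed

text \<open>Stone--Weierstrass on the unit circle in the complex plane replaces \<open>\<phi>\<close> by a polynomial, up to a
uniform error \<open>e\<close> that costs at most \<open>e\<close> times the \<open>L\<^sup>1\<close> norm of \<open>f\<close>.\<close>

lemma vanishing_coeffs_integral_continuous:
  fixes \<phi> :: "complex \<Rightarrow> real"
  assumes f: "integrable circle f" "\<And>k. fourier_coeff f k = 0" and \<phi>: "continuous_on UNIV \<phi>"
  shows "(\<integral>x. f x * of_real (\<phi> (cis x)) \<partial>circle) = 0"
proof -
  have [measurable]: "(\<lambda>x. \<phi> (cis x)) \<in> borel_measurable circle"
    by (intro borel_measurable_circle borel_measurable_continuous_onI 
        continuous_on_compose2[OF \<phi>] continuous_intros) auto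
  have [measurable]: "f \<in> borel_measurable circle" using f by auto
  have bound: "norm (\<integral>x. f x * of_real (\<phi> (cis x)) \<partial>circle) \<le> e * (\<integral>x. norm (f x) \<partial>circle)" if "e > 0" for e
  proof -
    obtain p where p: "real_polynomial_function p" and approx: "\<And>z. z \<in> sphere 0 1 \<Longrightarrow> \<bar>\<phi> z - p z\<bar> < e"
      using Stone_Weierstrass_real_polynomial_function[OF compact_sphere[of "0::complex" 1] 
          continuous_on_subset[OF \<phi> subset_UNIV] \<open>e > 0\<close>] by blast
    let ?P = "\<lambda>x. f x * of_real (p (cis x))" and ?R = "\<lambda>x. f x * of_real (\<phi> (cis x) - p (cis x))"
    have P: "integrable circle ?P" "fourier_coeff ?P 0 = 0"
      using vanishing_coeffs_mult_polynomial[OF p f] by auto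
    have [measurable]: "(\<lambda>x. p (cis x)) \<in> borel_measurable circle"
      by (intro borel_measurable_circle borel_measurable_continuous_onI 
        continuous_on_compose2[OF continuous_on_polymonial_function[of p UNIV]] continuous_intros)
         (use p in \<open>auto simp: real_polynomial_function_eq\<close>)
    have R_le: "norm (?R x) \<le> e * norm (f x)" for x
    proof -
      have "\<bar>\<phi> (cis x) - p (cis x)\<bar> \<le> e" using approx[of "cis x"] by simp
      from mult_left_mono[OF this norm_ge_zero[of "f x"]] show ?thesis
        by (simp add: norm_mult mult.commute flip: of_real_diff)
    qed
    have R: "integrable circle ?R"
    proof (rule Bochner_Integration.integrable_bound)
      show "integrable circle (\<lambda>x. e * norm (f x))" using f by simp
      show "?R \<in> borel_measurable circle" by measurable
      show "AE x in circle. norm (?R x) \<le> norm (e * norm (f x))"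
        using order_trans[OF R_le abs_ge_self] by simp
    qed
    have "(\<integral>x. f x * of_real (\<phi> (cis x)) \<partial>circle) = (\<integral>x. ?P x + ?R x \<partial>circle)"
      by (simp add: algebra_simps)
    also have "\<dots> = integral\<^sup>L circle ?R"
      using P R integral_circle_character[of ?P 0] by simp
    finally have "norm (\<integral>x. f x * of_real (\<phi> (cis x)) \<partial>circle) \<le> (\<integral>x. norm (?R x) \<partial>circle)"
      by simp
    also have "\<dots> \<le> (\<integral>x. e * norm (f x) \<partial>circle)"
      using R f R_le by (intro integral_mono) auto
    finally show ?thesis by simp
  qed
  have "norm (\<integral>x. f x * of_real (\<phi> (cis x)) \<partial>circle) \<le> 0"
  proof (rule tendsto_lowerbound)
    show "((\<lambda>e. e * (\<integral>x. norm (f x) \<partial>circle)) \<longlongrightarrow> 0) (at_right 0)"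
      by (intro tendsto_mult_left_zero tendsto_ident_at)
    show "\<forall>\<^sub>F e in at_right 0. norm (\<integral>x. f x * of_real (\<phi> (cis x)) \<partial>circle) \<le> e * (\<integral>x. norm (f x) \<partial>circle)"
      using eventually_at_right_less[of 0] by eventually_elim (rule bound)
  qed simp
  then show ?thesis by simp
qed

text \<open>The indicator of a closed set is the bounded pointwise limit of continuous functions of the distance
to the set.\<close>

lemma vanishing_coeffs_integral_closed:
  assumes f: "integrable circle f" "\<And>k. fourier_coeff f k = 0" and K: "closed K"
  shows "(\<integral>x. f x * indicator K (cis x) \<partial>circle) = 0"
proof (cases "K = {}")
  case False
  define \<phi> where "\<phi> = (\<lambda>n z. max 0 (1 - real n * infdist z K))"
  have [measurable]: "f \<in> borel_measurable circle" using f by auto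
  have cont: "continuous_on UNIV (\<phi> n)" for n
    unfolding \<phi>_def by (intro continuous_intros)
  have [measurable]: "(\<lambda>x. \<phi> n (cis x)) \<in> borel_measurable circle" for n
    by (intro borel_measurable_circle borel_measurable_continuous_onI 
        continuous_on_compose2[OF cont] continuous_intros) auto
  have [measurable]: "K \<in> sets borel" using K by auto
  have bounds: "0 \<le> \<phi> n z" "\<phi> n z \<le> 1" for n z
    by (auto simp: \<phi>_def infdist_nonneg)
  have lim: "(\<lambda>n. \<phi> n z) \<longlonglongrightarrow> indicator K z" for z
  proof (cases "z \<in> K")
    case False
    with K \<open>K \<noteq> {}\<close> have pos: "infdist z K > 0"
      by (metis in_closed_iff_infdist_zero infdist_nonneg less_eq_real_def)
    then obtain m :: nat where m: "1 < real m * infdist z K"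
      using reals_Archimedean3 by blast
    have "\<phi> n z = 0" if "n \<ge> m" for n
    proof -
      have "real m * infdist z K \<le> real n * infdist z K"
        using that pos by (intro mult_right_mono) auto
      with m show ?thesis by (simp add: \<phi>_def)
    qed
    then have "\<forall>\<^sub>F n in sequentially. \<phi> n z = 0" by (auto simp: eventually_sequentially)
    then show ?thesis using False by (simp add: tendsto_eventually)
  qed (simp add: \<phi>_def)
  have "(\<lambda>n. \<integral>x. f x * of_real (\<phi> n (cis x)) \<partial>circle) \<longlonglongrightarrow> (\<integral>x. f x * of_real (indicator K (cis x)) \<partial>circle)"
  proof (rule integral_dominated_convergence)
    show "integrable circle (\<lambda>x. norm (f x))" using f by simp
    show "AE x in circle. (\<lambda>n. f x * complex_of_real (\<phi> n (cis x))) \<longlonglongrightarrow> f x * complex_of_real (indicator K (cis x))"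
      by (intro AE_I2 tendsto_intros lim)
    show "AE x in circle. norm (f x * complex_of_real (\<phi> n (cis x))) \<le> norm (f x)" for n
      using bounds by (auto simp: norm_mult intro!: mult_left_le)
  qed measurable
  then have "(\<integral>x. f x * of_real (indicator K (cis x)) \<partial>circle) = 0"
    by (simp add: vanishing_coeffs_integral_continuous[OF f cont] LIMSEQ_const_iff)
  then show ?thesis by (simp add: of_real_indicator)
qed simp

text \<open>Closed sets form an intersection-stable generator of the Borel sets, and the sets for which the
integral vanishes form a Dynkin system.\<close>

lemma vanishing_coeffs_integral_borel:
  assumes f: "integrable circle f" "\<And>k. fourier_coeff f k = 0" and B: "B \<in> sets borel"
  shows "(\<integral>x. f x * indicator B (cis x) \<partial>circle) = 0"
proof -
  have [measurable]: "f \<in> borel_measurable circle" using f by auto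
  have borel: "sigma_sets UNIV (Collect closed) = sets (borel :: complex measure)"
    by (subst borel_eq_closed) simp
  have int: "integrable circle (\<lambda>x. f x * indicator A (cis x))" if "A \<in> sets borel" for A
  proof (rule Bochner_Integration.integrable_bound[OF f(1)])
    show "(\<lambda>x. f x * indicator A (cis x)) \<in> borel_measurable circle" using that by measurable
  qed (auto simp: indicator_def)
  have "Int_stable (Collect closed)" "Collect closed \<subseteq> Pow (UNIV :: complex set)" 
    "B \<in> sigma_sets UNIV (Collect closed)"
    using B by (auto simp: Int_stable_def borel)
  then show ?thesis
  proof (induction rule: sigma_sets_induct_disjoint)
    case (basic A)
    then show ?case by (intro vanishing_coeffs_integral_closed f) auto
  next
    case empty
    show ?case by simp
  next
    case (compl A)
    \<comment> \<open>The whole plane is closed, so the total integral vanishes as well.\<close>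
    have "(\<integral>x. f x \<partial>circle) = 0"
      using vanishing_coeffs_integral_closed[OF f closed_UNIV] by simp
    moreover have "f x * indicator (UNIV - A) (cis x) = f x - f x * indicator A (cis x)" for x
      by (auto simp: indicator_def)
    ultimately show ?case
      using compl f int[of A] by (simp add: borel)
  next
    case (union A)
    define X where "X = (\<lambda>i. cis -` A i \<inter> space circle)"
    have A: "A i \<in> sets borel" for i using union by (auto simp: borel)
    have X: "X i \<in> sets circle" for i
      unfolding X_def using A by (intro measurable_sets[OF cis_measurable_circle])
    have eq: "(\<integral>x. f x * indicator (A i) (cis x) \<partial>circle) = (LINT x:X i|circle. f x)" for i
      unfolding set_lebesgue_integral_def X_def 
      by (intro Bochner_Integration.integral_cong) (auto simp: indicator_def)
    have "(\<integral>x. f x * indicator (\<Union>i. A i) (cis x) \<partial>circle) = (LINT x:(\<Union>i. X i)|circle. f x)"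
      unfolding set_lebesgue_integral_def X_def 
      by (intro Bochner_Integration.integral_cong) (auto simp: indicator_def)
    also have "\<dots> = (\<Sum>i. LINT x:X i|circle. f x)"
    proof (rule lebesgue_integral_countable_add)
      show "X i \<inter> X j = {}" if "i \<noteq> j" for i j
        using union(1) that by (auto simp: X_def disjoint_family_on_def)
      show "set_integrable circle (\<Union>i. X i) f"
        using X f unfolding set_integrable_def by (intro integrable_mult_indicator) auto
    qed (rule X)
    also have "\<dots> = 0" using union(3) by (simp flip: eq)
    finally show ?case .
  qed
qed

text \<open>Every Borel subset of the interval is, up to the endpoints, the preimage under \<^const>\<open>cis\<close> of a
Borel subset of the plane, by means of the argument function. So the integral of \<open>f\<close> vanishes over
every measurable set. Integrability suffices here, and this generality is what allows the
coefficients to decide whether a product of two \<open>L\<^sup>2\<close> functions is again in \<open>L\<^sup>2\<close>.\<close>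

theorem fourier_coeff_eq_0_imp_AE_0:
  assumes f: "integrable circle f" "\<And>k. fourier_coeff f k = 0"
  shows "AE x in circle. f x = 0"
proof (rule circle.density_zero[OF f(1)])
  fix A assume "A \<in> sets circle"
  then obtain A' where A': "A' \<in> sets borel" "A = {-pi..pi} \<inter> A'"
    by (auto simp: circle_def sets_restrict_space)
  have [measurable]: "f \<in> borel_measurable circle" using f by auto
  have [measurable]: "A \<in> sets circle" by fact
  \<comment> \<open>The argument is continuous off the negative real axis only; it is cut off there to be Borel.\<close>
  define g where "g = (\<lambda>z. indicator (- \<real>\<^sub>\<le>\<^sub>0) z *\<^sub>R Arg z)"
  have "g \<in> borel_measurable borel"
    unfolding g_def by (intro borel_measurable_continuous_on_indicator continuous_on_Arg) auto
  then have B: "g -` A' \<in> sets borel"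
    using A'(1) by (auto dest: measurable_sets)
  have g_cis: "g (cis x) = x" if "x \<in> {-pi<..<pi}" for x
  proof -
    have Arg: "Arg (cis x) = x" using that by (intro cis_Arg_unique) auto
    have "cis x \<notin> \<real>\<^sub>\<le>\<^sub>0"
    proof
      assume "cis x \<in> \<real>\<^sub>\<le>\<^sub>0"
      then obtain r where r: "cis x = of_real r" "r \<le> 0" by (auto elim: nonpos_Reals_cases)
      then have "r \<noteq> 0" by (metis cis_neq_zero of_real_0)
      with r have "Arg (cis x) = pi" by simp
      with Arg that show False by simp
    qed
    with Arg show ?thesis by (simp add: g_def)
  qed
  have "(LINT x:A|circle. f x) = (\<integral>x. f x * indicator (g -` A') (cis x) \<partial>circle)"
    unfolding set_lebesgue_integral_def
  proof (rule integral_cong_AE)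
    have "AE x in lborel. x \<noteq> pi \<and> x \<noteq> - pi"
      using AE_lborel_singleton[of pi] AE_lborel_singleton[of "- pi"] by eventually_elim simp
    then have "AE x in circle. x \<noteq> pi \<and> x \<noteq> - pi"
      unfolding circle_def by (subst AE_restrict_space_iff) (auto elim: eventually_mono)
    with AE_space show "AE x in circle. indicator A x *\<^sub>R f x = f x * indicator (g -` A') (cis x)"
    proof eventually_elim
      case (elim x)
      then have "g (cis x) = x" by (intro g_cis) (auto simp: space_circle)
      with elim show ?case by (auto simp: A'(2) space_circle indicator_def)
    qed
    show "(\<lambda>x. f x * indicator (g -` A') (cis x)) \<in> borel_measurable circle" using B by measurable
  qed measurable
  then show "(LINT x:A|circle. f x) = 0"
    by (simp add: vanishing_coeffs_integral_borel[OF f B])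
qed

section \<open>Parseval's identity and convolution\<close>

lemma fourier_coeff_eq_imp_AE_eq:
  assumes "integrable circle f" "integrable circle g" "\<And>k. fourier_coeff f k = fourier_coeff g k"
  shows "AE x in circle. f x = g x"
  using fourier_coeff_eq_0_imp_AE_0[OF Bochner_Integration.integrable_diff[OF assms(1,2)]] assms
  by (simp add: fourier_coeff_diff)

text \<open>Riesz--Fischer provides an \<open>L\<^sup>2\<close> function with the coefficients of \<open>f\<close>, and uniqueness identifies it
with \<open>f\<close>. Square integrability is thus a conclusion, drawn from the coefficients alone.\<close>

theorem Parseval_integrable:
  assumes f: "integrable circle f" and sum: "(\<lambda>k. (norm (fourier_coeff f k))\<^sup>2) summable_on UNIV"
  shows "square_integrable f"
    and "((\<lambda>k. (norm (fourier_coeff f k))\<^sup>2) has_sum ((\<integral>x. (norm (f x))\<^sup>2 \<partial>circle) / (2 * pi))) UNIV"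
proof -
  obtain h where h: "square_integrable h" "\<And>k. fourier_coeff h k = fourier_coeff f k"
    "((\<lambda>k. (norm (fourier_coeff f k))\<^sup>2) has_sum ((\<integral>x. (norm (h x))\<^sup>2 \<partial>circle) / (2 * pi))) UNIV"
    using Riesz_Fischer[OF sum] by metis
  have [measurable]: "f \<in> borel_measurable circle" "h \<in> borel_measurable circle"
    using f h by (auto simp: square_integrable_def)
  have "AE x in circle. f x = h x"
    using h by (intro fourier_coeff_eq_imp_AE_eq f square_integrable_imp_integrable) auto
  then have AE: "AE x in circle. (norm (h x))\<^sup>2 = (norm (f x))\<^sup>2" by eventually_elim simp
  have "integrable circle (\<lambda>x. (norm (f x))\<^sup>2)"
    using h(1) AE unfolding square_integrable_def
    by (subst integrable_cong_AE[of _ _ "\<lambda>x. (norm (h x))\<^sup>2"]) auto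
  then show "square_integrable f" by (simp add: square_integrable_def)
  have "(\<integral>x. (norm (f x))\<^sup>2 \<partial>circle) = (\<integral>x. (norm (h x))\<^sup>2 \<partial>circle)"
    using AE by (intro integral_cong_AE) auto
  with h(3) show "((\<lambda>k. (norm (fourier_coeff f k))\<^sup>2) has_sum ((\<integral>x. (norm (f x))\<^sup>2 \<partial>circle) / (2 * pi))) UNIV"
    by simp
qed

lemma Parseval:
  assumes "square_integrable f"
  shows "((\<lambda>k. (norm (fourier_coeff f k))\<^sup>2) has_sum ((\<integral>x. (norm (f x))\<^sup>2 \<partial>circle) / (2 * pi))) UNIV"
  using Parseval_integrable(2)[OF square_integrable_imp_integrable[OF assms] summable_fourier_coeff_sq[OF assms]] .

lemma polarization_complex:
  "z * cnj w = (1/4) * (of_real ((norm (z + 1 * w))\<^sup>2) + (- 1) * of_real ((norm (z + (- 1) * w))\<^sup>2)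
     + \<i> * of_real ((norm (z + \<i> * w))\<^sup>2) + (- \<i>) * of_real ((norm (z + (- \<i>) * w))\<^sup>2))"
  by (simp only: cmod_power2) (simp add: complex_eq_iff power2_eq_square algebra_simps)

text \<open>Polarization, applied to the functions and to their coefficients.\<close>

lemma Parseval_inner:
  assumes "square_integrable f" "square_integrable g"
  shows "((\<lambda>k. fourier_coeff f k * cnj (fourier_coeff g k)) has_sum 
           ((\<integral>x. f x * cnj (g x) \<partial>circle) / of_real (2 * pi))) UNIV"
proof -
  define u where "u = (\<lambda>a x. f x + a * g x)"
  define J where "J = (\<lambda>a. \<integral>x. (norm (u a x))\<^sup>2 \<partial>circle)"
  have u: "square_integrable (u a)" for a
    unfolding u_def by (intro square_integrable_add square_integrable_cmult assms)
  have coeff: "fourier_coeff (u a) k = fourier_coeff f k + a * fourier_coeff g k" for a k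
    unfolding u_def using assms
    by (subst fourier_coeff_add) 
       (auto simp: fourier_coeff_cmult intro!: square_integrable_imp_integrable square_integrable_cmult)
  have sums: "((\<lambda>k. complex_of_real ((norm (fourier_coeff (u a) k))\<^sup>2)) has_sum of_real (J a / (2 * pi))) UNIV" for a
    using Parseval[OF u[of a]] unfolding J_def by (rule has_sum_of_real)
  have "((\<lambda>k. fourier_coeff f k * cnj (fourier_coeff g k)) has_sum 
       ((1/4) * (of_real (J 1 / (2 * pi)) + (- 1) * of_real (J (- 1) / (2 * pi))
        + \<i> * of_real (J \<i> / (2 * pi)) + (- \<i>) * of_real (J (- \<i>) / (2 * pi))))) UNIV"
    unfolding polarization_complex coeff[symmetric]
    by (intro has_sum_cmult_right has_sum_add sums)
  moreover have "(\<integral>x. f x * cnj (g x) \<partial>circle) = 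
     (1/4) * (of_real (J 1) + (- 1) * of_real (J (- 1)) + \<i> * of_real (J \<i>) + (- \<i>) * of_real (J (- \<i>)))"
  proof -
    have int: "integrable circle (\<lambda>x. complex_of_real ((norm (u a x))\<^sup>2))" for a
      using u[of a] unfolding square_integrable_def by (intro integrable_of_real) auto
    have J: "(\<integral>x. complex_of_real ((norm (u a x))\<^sup>2) \<partial>circle) = of_real (J a)" for a
      unfolding J_def by (rule integral_complex_of_real)
    have "(\<integral>x. f x * cnj (g x) \<partial>circle) = (\<integral>x. (1/4) * (of_real ((norm (u 1 x))\<^sup>2) 
      + (- 1) * of_real ((norm (u (- 1) x))\<^sup>2) + \<i> * of_real ((norm (u \<i> x))\<^sup>2) 
      + (- \<i>) * of_real ((norm (u (- \<i>) x))\<^sup>2)) \<partial>circle)"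
      unfolding u_def by (subst polarization_complex) (rule refl)
    also have "\<dots> = (1/4) * (of_real (J 1) + (- 1) * of_real (J (- 1)) + \<i> * of_real (J \<i>) + (- \<i>) * of_real (J (- \<i>)))"
      by (simp only: Bochner_Integration.integral_add integral_mult_right_zero int J
           Bochner_Integration.integrable_add integrable_mult_right)
    finally show ?thesis .
  qed
  moreover have "(1/4) * (a / t + (- 1) * (b / t) + \<i> * (c / t) + (- \<i>) * (d / t)) 
      = (1/4) * (a + (- 1) * b + \<i> * c + (- \<i>) * d) / t" for a b c d t :: complex
    by (simp add: add_divide_distrib diff_divide_distrib mult.commute)
  ultimately show ?thesis by (simp only: of_real_divide)
qed

text \<open>The coefficient of \<open>f g\<close> at \<open>n\<close> is the inner product of \<open>f\<close> with \<open>e\<^sup>i\<^sup>n\<^sup>x\<close> times the conjugate of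
\<open>g\<close>, whose coefficients are the reflected and shifted conjugates of those of \<open>g\<close>.\<close>

lemma fourier_coeff_mult:
  assumes "square_integrable f" "square_integrable g"
  shows "((\<lambda>k. fourier_coeff f k * fourier_coeff g (n - k)) has_sum fourier_coeff (\<lambda>x. f x * g x) n) UNIV"
proof -
  let ?g = "\<lambda>x. cnj (g x) * character n x"
  have "((\<lambda>k. fourier_coeff f k * cnj (fourier_coeff ?g k)) has_sum 
           ((\<integral>x. f x * cnj (?g x) \<partial>circle) / of_real (2 * pi))) UNIV"
    by (intro Parseval_inner assms square_integrable_mult_character square_integrable_cnj)
  moreover have "(\<integral>x. f x * cnj (?g x) \<partial>circle) = of_real (2 * pi) * fourier_coeff (\<lambda>x. f x * g x) n"
    using integral_circle_character[of "\<lambda>x. f x * g x" n] by (simp add: cnj_character mult.assoc)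
  ultimately show ?thesis by (simp add: fourier_coeff_mult_character fourier_coeff_cnj)
qed

lemma has_sum_product_nonneg:
  fixes p q :: "int \<Rightarrow> real"
  assumes p: "(p has_sum P) UNIV" "\<And>k. p k \<ge> 0" and q: "(q has_sum Q) UNIV" "\<And>k. q k \<ge> 0"
  shows "((\<lambda>(k, m). p k * q m) has_sum (P * Q)) (UNIV \<times> UNIV)"
proof (rule has_sum_SigmaI)
  have inner: "((\<lambda>m. p k * q m) has_sum (p k * Q)) UNIV" for k
    by (intro has_sum_cmult_right q)
  then show "((\<lambda>m. case (k, m) of (k, m) \<Rightarrow> p k * q m) has_sum (p k * Q)) UNIV" for k by simp
  show outer: "((\<lambda>k. p k * Q) has_sum (P * Q)) UNIV"
    by (intro has_sum_cmult_left p)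
  show "(\<lambda>(k, m). p k * q m) summable_on UNIV \<times> UNIV"
    using inner outer p(2) q(2) by (intro summable_on_SigmaI) (auto simp: summable_on_def)
qed

text \<open>Tonelli for the change of variables \<open>(n, k) \<mapsto> (k, n - k)\<close> on pairs of integers.\<close>

lemma has_sum_convolution_nonneg:
  fixes p q :: "int \<Rightarrow> real"
  assumes p: "(p has_sum P) UNIV" "\<And>k. p k \<ge> 0" and q: "(q has_sum Q) UNIV" "\<And>k. q k \<ge> 0"
  shows "(\<lambda>k. p k * q (n - k)) summable_on UNIV"
    and "((\<lambda>n. \<Sum>\<^sub>\<infinity>k. p k * q (n - k)) has_sum (P * Q)) UNIV"
proof -
  have sum: "((\<lambda>(n, k). p k * q (n - k)) has_sum (P * Q)) (UNIV \<times> UNIV)"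
    by (subst has_sum_reindex_bij_witness[where i = "\<lambda>(k, m). (k + m, k)" and j = "\<lambda>(n, k). (k, n - k)" 
           and T = "UNIV \<times> UNIV" and h = "\<lambda>(k, m). p k * q m" and s' = "P * Q"])
       (use has_sum_product_nonneg[OF assms] in auto)
  then have "(\<lambda>(n, k). p k * q (n - k)) summable_on UNIV \<times> UNIV" by (auto simp: summable_on_def)
  then show slice: "(\<lambda>k. p k * q (n - k)) summable_on UNIV" for n
    by (rule summable_on_SigmaD1) simp
  show "((\<lambda>n. \<Sum>\<^sub>\<infinity>k. p k * q (n - k)) has_sum (P * Q)) UNIV"
    by (rule has_sum_SigmaD[OF sum]) (use slice in auto)
qed

text \<open>A weighted Young inequality. By the Cauchy--Schwarz inequality with weight \<open>w k * w (n - k)\<close>, the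
square of \<open>|b n|\<close> is at most the product of two factors: the convolution of \<open>w |c|\<^sup>2\<close> with \<open>w |d|\<^sup>2\<close> at \<open>n\<close>,
whose sum over \<open>n\<close> is \<open>P Q\<close>, and the sum of \<open>1 / (w k * w (n - k))\<close> over \<open>k\<close>, which is at
most \<open>A\<close> for every \<open>n\<close> by the inequality of the arithmetic and geometric means.\<close>

lemma convolution_square_summable:
  fixes c d b :: "int \<Rightarrow> complex" and w :: "int \<Rightarrow> real"
  assumes w: "\<And>k. w k > 0" and A: "((\<lambda>k. 1 / (w k)\<^sup>2) has_sum A) UNIV"
    and P: "((\<lambda>k. w k * (norm (c k))\<^sup>2) has_sum P) UNIV"
    and Q: "((\<lambda>k. w k * (norm (d k))\<^sup>2) has_sum Q) UNIV"
    and b: "\<And>n. ((\<lambda>k. c k * d (n - k)) has_sum b n) UNIV"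
  shows "(\<lambda>n. (norm (b n))\<^sup>2) summable_on UNIV" "(\<Sum>\<^sub>\<infinity>n. (norm (b n))\<^sup>2) \<le> A * (P * Q)"
proof -
  define p q where "p = (\<lambda>k. w k * (norm (c k))\<^sup>2)" and "q = (\<lambda>k. w k * (norm (d k))\<^sup>2)"
  have pq0: "p k \<ge> 0" "q k \<ge> 0" for k
    using w[of k] by (auto simp: p_def q_def)
  define R where "R = (\<lambda>n. \<Sum>\<^sub>\<infinity>k. p k * q (n - k))"
  have slice: "(\<lambda>k. p k * q (n - k)) summable_on UNIV" for n
    by (intro has_sum_convolution_nonneg(1)[where P = P and Q = Q]) (use P Q pq0 in \<open>auto simp: p_def q_def\<close>)
  have R: "(R has_sum (P * Q)) UNIV"
    unfolding R_def
    by (intro has_sum_convolution_nonneg(2)) (use P Q pq0 in \<open>auto simp: p_def q_def\<close>)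
  have R0: "R n \<ge> 0" for n
    unfolding R_def using pq0 by (intro infsum_nonneg) auto
  have A0: "A \<ge> 0" using A by (rule has_sum_nonneg) auto
  have A_part: "(\<Sum>k\<in>F. 1 / (w k)\<^sup>2) \<le> A" if "finite F" for F
    using has_sum_mono2[OF has_sum_finite[OF that] A] by auto
  have bound: "(norm (b n))\<^sup>2 \<le> A * R n" for n
  proof -
    have "norm (\<Sum>k\<in>F. c k * d (n - k)) \<le> sqrt (A * R n)" if F: "finite F" for F
    proof (rule real_le_rsqrt)
      let ?x = "\<lambda>k. 1 / sqrt (w k * w (n - k))" and ?y = "\<lambda>k. sqrt (w k * w (n - k)) * (norm (c k) * norm (d (n - k)))"
      have "norm (\<Sum>k\<in>F. c k * d (n - k)) \<le> (\<Sum>k\<in>F. ?x k * ?y k)"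
      proof (rule sum_norm_le)
        show "norm (c k * d (n - k)) \<le> ?x k * ?y k" for k
          using w[of k] w[of "n - k"] by (simp add: norm_mult)
      qed
      then have "(norm (\<Sum>k\<in>F. c k * d (n - k)))\<^sup>2 \<le> (\<Sum>k\<in>F. ?x k * ?y k)\<^sup>2"
        by (intro power_mono) auto
      also have "\<dots> \<le> (\<Sum>k\<in>F. (?x k)\<^sup>2) * (\<Sum>k\<in>F. (?y k)\<^sup>2)"
        by (rule Cauchy_Schwarz_ineq_sum)
      also have "\<dots> \<le> A * R n"
      proof (intro mult_mono)
        have "(?x k)\<^sup>2 \<le> (1 / (w k)\<^sup>2 + 1 / (w (n - k))\<^sup>2) / 2" for k
        proof -
          have "(?x k)\<^sup>2 = (1 / w k) * (1 / w (n - k))"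
            using w[of k] w[of "n - k"] by (simp add: power_divide)
          also have "2 * \<dots> \<le> (1 / w k)\<^sup>2 + (1 / w (n - k))\<^sup>2"
            using sum_squares_bound[of "1 / w k" "1 / w (n - k)"] by simp
          finally show ?thesis by (simp add: power_divide)
        qed
        then have "(\<Sum>k\<in>F. (?x k)\<^sup>2) \<le> (\<Sum>k\<in>F. (1 / (w k)\<^sup>2 + 1 / (w (n - k))\<^sup>2) / 2)"
          by (rule sum_mono)
        also have "\<dots> = ((\<Sum>k\<in>F. 1 / (w k)\<^sup>2) + (\<Sum>k\<in>(\<lambda>k. n - k) ` F. 1 / (w k)\<^sup>2)) / 2"
          by (subst sum.reindex) (auto simp: inj_on_def sum.distrib simp flip: sum_divide_distrib)
        also have "\<dots> \<le> A"
          using A_part[OF F] A_part[of "(\<lambda>k. n - k) ` F"] F by simp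
        finally show "(\<Sum>k\<in>F. (?x k)\<^sup>2) \<le> A" .
        have "(?y k)\<^sup>2 = p k * q (n - k)" for k
          using w[of k] w[of "n - k"] by (simp add: power_mult_distrib p_def q_def)
        then have "(\<Sum>k\<in>F. (?y k)\<^sup>2) = (\<Sum>k\<in>F. p k * q (n - k))" by simp
        also have "\<dots> \<le> R n"
          unfolding R_def using pq0 by (intro finite_sum_le_infsum slice F) auto
        finally show "(\<Sum>k\<in>F. (?y k)\<^sup>2) \<le> R n" .
      qed (auto intro: A0 sum_nonneg)
      finally show "(norm (\<Sum>k\<in>F. c k * d (n - k)))\<^sup>2 \<le> A * R n" .
    qed
    then have "norm (b n) \<le> sqrt (A * R n)"
      using b[of n] unfolding has_sum_def
      by (intro Lim_norm_ubound) (auto intro: eventually_finite_subsets_at_top_weakI)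
    then have "(norm (b n))\<^sup>2 \<le> (sqrt (A * R n))\<^sup>2" by (intro power_mono) auto
    then show ?thesis using A0 R0[of n] by simp
  qed
  have AR: "((\<lambda>n. A * R n) has_sum (A * (P * Q))) UNIV"
    by (intro has_sum_cmult_right R)
  then show sum: "(\<lambda>n. (norm (b n))\<^sup>2) summable_on UNIV"
    by (rule summable_on_comparison_test[OF has_sum_imp_summable]) (auto simp: bound)
  show "(\<Sum>\<^sub>\<infinity>n. (norm (b n))\<^sup>2) \<le> A * (P * Q)"
    using has_sum_mono[OF has_sum_infsum[OF sum] AR bound] .
qed

section \<open>Periodic Sobolev spaces and the product estimate\<close>

definition bracket :: "real \<Rightarrow> int \<Rightarrow> real" where
  "bracket r k = (1 + (real_of_int k)\<^sup>2) powr r"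

text \<open>Up to the factor \<open>2 \<pi>\<close>, the squared norm of \<open>H\<^sup>r\<close>.\<close>

definition sobolev_sq :: "real \<Rightarrow> (real \<Rightarrow> complex) \<Rightarrow> real" where
  "sobolev_sq r f = (\<Sum>\<^sub>\<infinity>k. bracket r k * (norm (fourier_coeff f k))\<^sup>2)"

lemma bracket_pos: "bracket r k > 0"
proof -
  have "1 + (real_of_int k)\<^sup>2 > 0" by (rule add_pos_nonneg) auto
  then show ?thesis by (simp add: bracket_def)
qed

lemma bracket_nonneg [simp]: "bracket r k \<ge> 0"
  using bracket_pos[of r k] by simp

lemma bracket_mono: "r \<le> s \<Longrightarrow> bracket r k \<le> bracket s k"
  unfolding bracket_def by (intro powr_mono) auto

lemma bracket_0 [simp]: "bracket 0 k = 1"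
proof -
  have "1 + (real_of_int k)\<^sup>2 > 0" by (rule add_pos_nonneg) auto
  then show ?thesis by (simp add: bracket_def)
qed

lemma bracket_ge_1: "0 \<le> r \<Longrightarrow> 1 \<le> bracket r k"
  using bracket_mono[of 0 r k] by simp

text \<open>Comparison with the \<open>p\<close>-series on each half of the integers.\<close>

lemma summable_bracket:
  assumes "r < - (1 / 2)"
  shows "bracket r summable_on UNIV"
proof -
  have "summable (\<lambda>n. real n powr (2 * r))"
    using assms by (simp add: summable_real_powr_iff)
  then have "summable (\<lambda>n. norm (bracket r (int n)))"
  proof (rule summable_comparison_test_ev[rotated])
    have "norm (norm (bracket r (int n))) \<le> real n powr (2 * r)" if "n \<ge> 1" for n
    proof -
      have "bracket r (int n) \<le> ((real n)\<^sup>2) powr r"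
        using that assms unfolding bracket_def by (intro powr_mono2') auto
      also have "\<dots> = real n powr (2 * r)"
        using that by (simp add: powr_powr flip: powr_numeral)
      finally show ?thesis by simp
    qed
    then show "\<forall>\<^sub>F n in sequentially. norm (norm (bracket r (int n))) \<le> real n powr (2 * r)"
      by (auto simp: eventually_sequentially)
  qed
  then have nat: "(\<lambda>n. bracket r (int n)) summable_on UNIV"
    by (rule norm_summable_imp_summable_on)
  have "bracket r summable_on range int"
    using nat by (subst summable_on_reindex) (auto simp: o_def)
  moreover have "bracket r summable_on range (\<lambda>n. - int n)"
    using nat by (subst summable_on_reindex) (auto simp: o_def inj_on_def bracket_def)
  ultimately have "bracket r summable_on (range int \<union> range (\<lambda>n. - int n))"
    by (rule summable_on_union)
  moreover have "range int \<union> range (\<lambda>n. - int n) = UNIV"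
  proof -
    have "k \<in> range int \<union> range (\<lambda>n. - int n)" for k
      by (cases k rule: int_cases2) auto
    then show ?thesis by auto
  qed
  ultimately show ?thesis by simp
qed

lemma L2_per_imp_square_integrable: "f \<in> L2_per \<Longrightarrow> square_integrable f"
  unfolding L2_per_def square_integrable_def integrable_circle_iff
  by (auto intro: borel_measurable_circle)

lemma L2_per_iff: "f \<in> L2_per \<longleftrightarrow> (\<forall>x. f (x + 2 * pi) = f x) \<and> f \<in> borel_measurable borel \<and> square_integrable f"
  unfolding L2_per_def square_integrable_def integrable_circle_iff
  by (auto intro: borel_measurable_circle)

lemma H_per_iff: 
  "f \<in> H_per s \<longleftrightarrow> f \<in> L2_per \<and> (\<lambda>k. bracket s k * (norm (fourier_coeff f k))\<^sup>2) summable_on UNIV"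
  by (simp add: H_per_def bracket_def)

lemma H_per_imp_square_integrable: "f \<in> H_per s \<Longrightarrow> square_integrable f"
  by (simp add: H_per_iff L2_per_imp_square_integrable)

lemma has_sum_sobolev_sq:
  "f \<in> H_per s \<Longrightarrow> ((\<lambda>k. bracket s k * (norm (fourier_coeff f k))\<^sup>2) has_sum sobolev_sq s f) UNIV"
  unfolding sobolev_sq_def H_per_iff by (intro has_sum_infsum) simp

lemma sobolev_sq_nonneg [simp]: "sobolev_sq s f \<ge> 0"
  unfolding sobolev_sq_def by (intro infsum_nonneg) simp

lemma
  assumes "f \<in> H_per s" "r \<le> s"
  shows H_per_mono: "f \<in> H_per r" and sobolev_sq_mono: "sobolev_sq r f \<le> sobolev_sq s f"
proof -
  have le: "bracket r k * (norm (fourier_coeff f k))\<^sup>2 \<le> bracket s k * (norm (fourier_coeff f k))\<^sup>2" for k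
    by (intro mult_right_mono bracket_mono assms) simp
  have "(\<lambda>k. bracket r k * (norm (fourier_coeff f k))\<^sup>2) summable_on UNIV"
    by (rule summable_on_comparison_test[OF has_sum_imp_summable[OF has_sum_sobolev_sq[OF assms(1)]]]) (simp_all add: le)
  then show *: "f \<in> H_per r" using assms(1) by (simp add: H_per_iff)
  show "sobolev_sq r f \<le> sobolev_sq s f"
    by (rule has_sum_mono[OF has_sum_sobolev_sq[OF *] has_sum_sobolev_sq[OF assms(1)] le])
qed

lemma
  assumes f: "f \<in> H_per s" and g: "g \<in> H_per s"
  shows H_per_add: "(\<lambda>x. f x + g x) \<in> H_per s" 
    and sobolev_sq_add: "sobolev_sq s (\<lambda>x. f x + g x) \<le> 2 * sobolev_sq s f + 2 * sobolev_sq s g"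
proof -
  have sq: "square_integrable f" "square_integrable g" using f g by (auto intro: H_per_imp_square_integrable)
  have le: "bracket s k * (norm (fourier_coeff (\<lambda>x. f x + g x) k))\<^sup>2 \<le> 
     2 * (bracket s k * (norm (fourier_coeff f k))\<^sup>2) + 2 * (bracket s k * (norm (fourier_coeff g k))\<^sup>2)" for k
  proof -
    have "(norm (z + w))\<^sup>2 \<le> 2 * (norm z)\<^sup>2 + 2 * (norm w)\<^sup>2" for z w :: complex
      using norm_add_sq_complex[of z w] norm_diff_sq_complex[of z w] zero_le_power2[of "norm (z - w)"] by linarith
    from mult_left_mono[OF this[of "fourier_coeff f k" "fourier_coeff g k"] bracket_nonneg[of s k]]
    show ?thesis
      using sq by (simp add: fourier_coeff_add square_integrable_imp_integrable algebra_simps)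
  qed
  have sum: "((\<lambda>k. 2 * (bracket s k * (norm (fourier_coeff f k))\<^sup>2) + 2 * (bracket s k * (norm (fourier_coeff g k))\<^sup>2)) 
      has_sum (2 * sobolev_sq s f + 2 * sobolev_sq s g)) UNIV"
    by (intro has_sum_add has_sum_cmult_right has_sum_sobolev_sq f g)
  have "(\<lambda>k. bracket s k * (norm (fourier_coeff (\<lambda>x. f x + g x) k))\<^sup>2) summable_on UNIV"
    by (rule summable_on_comparison_test[OF has_sum_imp_summable[OF sum]]) (simp_all add: le)
  moreover have "(\<lambda>x. f x + g x) \<in> L2_per"
    using f g by (auto simp: H_per_iff L2_per_iff intro: square_integrable_add)
  ultimately show *: "(\<lambda>x. f x + g x) \<in> H_per s" by (simp add: H_per_iff)
  show "sobolev_sq s (\<lambda>x. f x + g x) \<le> 2 * sobolev_sq s f + 2 * sobolev_sq s g"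
    by (rule has_sum_mono[OF has_sum_sobolev_sq[OF *] sum le])
qed

lemma H_per_cmult:
  assumes "f \<in> H_per s"
  shows "(\<lambda>x. a * f x) \<in> H_per s"
proof -
  have "(\<lambda>k. (norm a)\<^sup>2 * (bracket s k * (norm (fourier_coeff f k))\<^sup>2)) summable_on UNIV"
    using assms by (intro summable_on_cmult_right) (simp add: H_per_iff)
  then show ?thesis using assms
    by (auto simp: H_per_iff L2_per_iff fourier_coeff_cmult norm_mult power_mult_distrib mult_ac 
        intro: square_integrable_cmult)
qed

lemma sobolev_sq_uminus: "sobolev_sq s (\<lambda>x. - f x) = sobolev_sq s f"
  using fourier_coeff_cmult[of "-1" f] by (simp add: sobolev_sq_def)

lemma
  assumes f: "f \<in> H_per s" and g: "g \<in> H_per s"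
  shows H_per_diff: "(\<lambda>x. f x - g x) \<in> H_per s" 
    and sobolev_sq_diff: "sobolev_sq s (\<lambda>x. f x - g x) \<le> 2 * sobolev_sq s f + 2 * sobolev_sq s g"
  using H_per_add[OF f H_per_cmult[OF g, of "-1"]] sobolev_sq_add[OF f H_per_cmult[OF g, of "-1"]]
  by (simp_all add: sobolev_sq_uminus)

text \<open>The Sobolev embedding of \<open>H\<^sup>r\<close> into \<open>L\<^sup>4\<close>, in bilinear form: the choice \<open>f = g\<close> bounds the \<open>L\<^sup>4\<close> norm.
The exponent enters through the square sum of the reciprocal weights, which is finite exactly for
\<open>r > 1/4\<close>. The bilinear form serves to estimate the difference of two squares by its factors.\<close>

theorem product_estimate:
  assumes "1 / 4 < r"
  obtains C where "C \<ge> 0"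
    "\<And>f g. f \<in> H_per r \<Longrightarrow> g \<in> H_per r \<Longrightarrow> square_integrable (\<lambda>x. f x * g x)"
    "\<And>f g. f \<in> H_per r \<Longrightarrow> g \<in> H_per r \<Longrightarrow> 
       (\<integral>x. (norm (f x * g x))\<^sup>2 \<partial>circle) \<le> C * sobolev_sq r f * sobolev_sq r g"
proof -
  have "1 / (bracket r k)\<^sup>2 = bracket (- (2 * r)) k" for k
    by (simp add: bracket_def powr_minus power2_eq_square inverse_eq_divide flip: powr_add)
  then have "(\<lambda>k. 1 / (bracket r k)\<^sup>2) summable_on UNIV"
    using summable_bracket[of "- (2 * r)"] assms by simp
  then obtain A where A: "((\<lambda>k. 1 / (bracket r k)\<^sup>2) has_sum A) UNIV"
    by (auto simp: summable_on_def)
  then have A0: "A \<ge> 0" by (rule has_sum_nonneg) auto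
  have main: "square_integrable (\<lambda>x. f x * g x)"
    "(\<integral>x. (norm (f x * g x))\<^sup>2 \<partial>circle) \<le> (2 * pi * A) * sobolev_sq r f * sobolev_sq r g"
    if f: "f \<in> H_per r" and g: "g \<in> H_per r" for f g
  proof -
    have sq: "square_integrable f" "square_integrable g" 
      using f g by (auto intro: H_per_imp_square_integrable)
    note conv = convolution_square_summable[OF bracket_pos A has_sum_sobolev_sq[OF f] 
        has_sum_sobolev_sq[OF g] fourier_coeff_mult[OF sq]]
    note Pars = Parseval_integrable[OF integrable_mult_square_integrable[OF sq] conv(1)]
    show "square_integrable (\<lambda>x. f x * g x)" by (rule Pars(1))
    have "(\<integral>x. (norm (f x * g x))\<^sup>2 \<partial>circle) / (2 * pi) \<le> A * (sobolev_sq r f * sobolev_sq r g)"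
      using conv(2) infsumI[OF Pars(2)] by simp
    then show "(\<integral>x. (norm (f x * g x))\<^sup>2 \<partial>circle) \<le> (2 * pi * A) * sobolev_sq r f * sobolev_sq r g"
      by (simp add: field_simps)
  qed
  show thesis
    using that[of "2 * pi * A"] main A0 by simp
qed

section \<open>Compactness of the embedding into \<open>L\<^sup>4\<close>\<close>

text \<open>Continuity of the \<open>L\<^sup>2\<close> norm. The inequality
\<open>| |a|\<^sup>2 - |b|\<^sup>2 | \<le> e |b|\<^sup>2 + (1 + 1/e) |a - b|\<^sup>2\<close> integrates directly and takes the place of
Minkowski's inequality.\<close>

lemma integral_norm_sq_tendsto:
  assumes f: "\<And>j. square_integrable (f j)" and g: "square_integrable g"
    and lim: "(\<lambda>j. \<integral>x. (norm (f j x - g x))\<^sup>2 \<partial>circle) \<longlonglongrightarrow> 0"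
  shows "(\<lambda>j. \<integral>x. (norm (f j x))\<^sup>2 \<partial>circle) \<longlonglongrightarrow> (\<integral>x. (norm (g x))\<^sup>2 \<partial>circle)"
proof -
  define G D I where "G = (\<integral>x. (norm (g x))\<^sup>2 \<partial>circle)" 
    and "D = (\<lambda>j. \<integral>x. (norm (f j x - g x))\<^sup>2 \<partial>circle)" and "I = (\<lambda>j. \<integral>x. (norm (f j x))\<^sup>2 \<partial>circle)"
  have G0: "G \<ge> 0" by (simp add: G_def)
  have bound: "\<bar>I j - G\<bar> \<le> e * G + (1 + 1 / e) * D j" if e: "e > 0" for e j
  proof -
    have pointwise: "\<bar>(norm a)\<^sup>2 - (norm b)\<^sup>2\<bar> \<le> e * (norm b)\<^sup>2 + (1 + 1 / e) * (norm (a - b))\<^sup>2" for a b :: complex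
    proof -
      have "(norm a)\<^sup>2 = (norm (a - b))\<^sup>2 + 2 * Re ((a - b) * cnj b) + (norm b)\<^sup>2"
        using norm_add_sq_complex[of "a - b" b] by simp
      moreover have "\<bar>Re ((a - b) * cnj b)\<bar> \<le> norm (a - b) * norm b"
        using abs_Re_le_cmod[of "(a - b) * cnj b"] by (simp add: norm_mult)
      moreover have "2 * (norm (a - b) * norm b) \<le> e * (norm b)\<^sup>2 + (1 / e) * (norm (a - b))\<^sup>2"
      proof -
        have "2 * ((norm (a - b) / sqrt e) * (sqrt e * norm b)) \<le> (norm (a - b) / sqrt e)\<^sup>2 + (sqrt e * norm b)\<^sup>2"
          using sum_squares_bound[of "norm (a - b) / sqrt e" "sqrt e * norm b"] by (simp only: mult.assoc)
        then show ?thesis using e by (simp add: power_divide power_mult_distrib field_simps)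
      qed
      ultimately show ?thesis
        using zero_le_power2[of "norm (a - b)"] unfolding distrib_right abs_le_iff by linarith
    qed
    have int: "integrable circle (\<lambda>x. (norm (f j x))\<^sup>2)" "integrable circle (\<lambda>x. (norm (g x))\<^sup>2)" 
      "integrable circle (\<lambda>x. (norm (f j x - g x))\<^sup>2)"
      using f g square_integrable_diff[OF f g] by (auto simp: square_integrable_def)
    have "\<bar>I j - G\<bar> = \<bar>\<integral>x. (norm (f j x))\<^sup>2 - (norm (g x))\<^sup>2 \<partial>circle\<bar>"
      using int by (simp add: I_def G_def)
    also have "\<dots> \<le> (\<integral>x. \<bar>(norm (f j x))\<^sup>2 - (norm (g x))\<^sup>2\<bar> \<partial>circle)"
      by (rule integral_abs_bound)
    also have "\<dots> \<le> (\<integral>x. e * (norm (g x))\<^sup>2 + (1 + 1 / e) * (norm (f j x - g x))\<^sup>2 \<partial>circle)"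
      using int pointwise by (intro integral_mono) auto
    also have "\<dots> = e * G + (1 + 1 / e) * D j"
      using int by (simp add: G_def D_def)
    finally show ?thesis .
  qed
  have "I \<longlonglongrightarrow> G"
  proof (rule tendstoI)
    fix \<epsilon> :: real assume \<epsilon>: "\<epsilon> > 0"
    define e where "e = \<epsilon> / (2 * (G + 1))"
    have e: "e > 0" using \<epsilon> G0 by (simp add: e_def)
    have eG: "e * G \<le> \<epsilon> / 2" using \<epsilon> G0 by (simp add: e_def field_simps)
    have "(\<lambda>j. (1 + 1 / e) * D j) \<longlonglongrightarrow> 0"
      using lim unfolding D_def by (rule tendsto_mult_right_zero)
    then have "\<forall>\<^sub>F j in sequentially. (1 + 1 / e) * D j < \<epsilon> / 2"
      by (rule order_tendstoD) (use \<epsilon> in simp)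
    then show "\<forall>\<^sub>F j in sequentially. dist (I j) G < \<epsilon>"
    proof eventually_elim
      case (elim j)
      then show ?case using bound[OF e, of j] eG unfolding dist_real_def by linarith
    qed
  qed
  then show ?thesis by (simp add: I_def G_def)
qed

text \<open>The compactness mechanism: outside \<open>[-n, n]\<close> the weaker weight is at most \<open>(1 + n\<^sup>2)\<^sup>r\<^sup>-\<^sup>s\<close> times the
stronger one, which makes the tails uniformly small, and inside there are only finitely many
coefficients.\<close>

lemma sobolev_sq_tendsto_0_of_coeffs:
  assumes d: "\<And>j. d j \<in> H_per s" and bound: "\<And>j. sobolev_sq s (d j) \<le> M" and "r < s"
    and lim: "\<And>k. (\<lambda>j. fourier_coeff (d j) k) \<longlonglongrightarrow> 0"
  shows "(\<lambda>j. sobolev_sq r (d j)) \<longlonglongrightarrow> 0"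
proof (rule tendstoI)
  fix \<epsilon> :: real assume \<epsilon>: "\<epsilon> > 0"
  have M0: "M \<ge> 0" using bound[of 0] sobolev_sq_nonneg[of s "d 0"] by linarith
  have "filterlim (\<lambda>n. 1 + (real n)\<^sup>2) at_top sequentially"
    by (intro filterlim_tendsto_add_at_top[OF tendsto_const] filterlim_pow_at_top filterlim_real_sequentially) simp
  then have "((\<lambda>n. (1 + (real n)\<^sup>2) powr (r - s)) \<longlonglongrightarrow> 0)"
    using \<open>r < s\<close> by (intro tendsto_neg_powr) auto
  then have "((\<lambda>n. (1 + (real n)\<^sup>2) powr (r - s) * M) \<longlonglongrightarrow> 0)"
    by (rule tendsto_mult_left_zero)
  then have "\<forall>\<^sub>F n in sequentially. (1 + (real n)\<^sup>2) powr (r - s) * M < \<epsilon> / 2"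
    by (rule order_tendstoD) (use \<epsilon> in simp)
  then obtain n where n: "(1 + (real n)\<^sup>2) powr (r - s) * M < \<epsilon> / 2"
    by (auto simp: eventually_sequentially)
  define q where "q = (1 + (real n)\<^sup>2) powr (r - s)"
  have q0: "q \<ge> 0" by (simp add: q_def)
  define box where "box = {- int n..int n}"
  have split: "sobolev_sq r (d j) \<le> (\<Sum>k\<in>box. bracket r k * (norm (fourier_coeff (d j) k))\<^sup>2) + q * M" for j
  proof -
    let ?c = "\<lambda>k. (norm (fourier_coeff (d j) k))\<^sup>2"
    have le: "bracket r k * ?c k \<le> (if k \<in> box then bracket r k * ?c k else 0) + q * (bracket s k * ?c k)" for k
    proof (cases "k \<in> box")
      case True
      then show ?thesis using q0 by simp
    next
      case False
      then have "int n \<le> \<bar>k\<bar>" by (auto simp: box_def)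
      then have "real n \<le> \<bar>real_of_int k\<bar>" by linarith
      then have "(real n)\<^sup>2 \<le> (real_of_int k)\<^sup>2" using power_mono[of "real n" "\<bar>real_of_int k\<bar>" 2] by simp
      then have "bracket (r - s) k \<le> q"
        using \<open>r < s\<close> unfolding bracket_def q_def by (intro powr_mono2') (auto intro: add_pos_nonneg)
      then have "bracket (r - s) k * bracket s k \<le> q * bracket s k"
        by (rule mult_right_mono) simp
      then have "bracket r k \<le> q * bracket s k"
        by (simp add: bracket_def flip: powr_add)
      then show ?thesis using False by (simp add: mult_right_mono flip: mult.assoc)
    qed
    have sum1: "((\<lambda>k. if k \<in> box then bracket r k * ?c k else 0) has_sum (\<Sum>k\<in>box. bracket r k * ?c k)) UNIV"
      by (rule has_sum_finite_neutralI[of box]) (auto simp: box_def)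
    have sum2: "((\<lambda>k. q * (bracket s k * ?c k)) has_sum (q * sobolev_sq s (d j))) UNIV"
      by (intro has_sum_cmult_right has_sum_sobolev_sq d)
    have "d j \<in> H_per r" using H_per_mono[OF d] \<open>r < s\<close> by simp
    from has_sum_mono[OF has_sum_sobolev_sq[OF this] has_sum_add[OF sum1 sum2] le]
    have "sobolev_sq r (d j) \<le> (\<Sum>k\<in>box. bracket r k * ?c k) + q * sobolev_sq s (d j)" .
    also have "q * sobolev_sq s (d j) \<le> q * M" using q0 by (intro mult_left_mono bound) simp
    finally show ?thesis by simp
  qed
  have "(\<lambda>j. \<Sum>k\<in>box. bracket r k * (norm (fourier_coeff (d j) k))\<^sup>2) \<longlonglongrightarrow> (\<Sum>k\<in>box. bracket r k * (norm (0::complex))\<^sup>2)"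
    by (intro tendsto_intros lim)
  then have "(\<lambda>j. \<Sum>k\<in>box. bracket r k * (norm (fourier_coeff (d j) k))\<^sup>2) \<longlonglongrightarrow> 0" by simp
  then have "\<forall>\<^sub>F j in sequentially. (\<Sum>k\<in>box. bracket r k * (norm (fourier_coeff (d j) k))\<^sup>2) < \<epsilon> / 2"
    by (rule order_tendstoD) (use \<epsilon> in simp)
  then show "\<forall>\<^sub>F j in sequentially. dist (sobolev_sq r (d j)) 0 < \<epsilon>"
  proof eventually_elim
    case (elim j)
    then show ?case using split[of j] n by (simp add: q_def)
  qed
qed

text \<open>A sequence bounded in \<open>H\<^sup>s\<close> whose coefficients converge has a limit \<open>\<Phi>\<close> by Riesz--Fischer, and it
converges to \<open>\<Phi>\<close> strongly in \<open>H\<^sup>r\<close> for each \<open>r < s\<close>. For \<open>r\<close> strictly between \<open>1/4\<close> and \<open>s\<close> the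
product estimate bounds \<open>u\<^sub>j\<^sup>2 - \<Phi>\<^sup>2 = (u\<^sub>j - \<Phi>) (u\<^sub>j + \<Phi>)\<close> in \<open>L\<^sup>2\<close>, so the \<open>L\<^sup>4\<close> norms converge.\<close>

theorem compact_embedding_L4:
  assumes "1 / 4 < s" and u: "\<And>j. u j \<in> H_per s" and bound: "\<And>j. sobolev_sq s (u j) \<le> M"
    and lim: "\<And>k. (\<lambda>j. fourier_coeff (u j) k) \<longlonglongrightarrow> c k"
  obtains \<Phi> where "\<Phi> \<in> H_per s" "\<And>k. fourier_coeff \<Phi> k = c k"
    "(\<lambda>j. \<integral>x. (norm (u j x)) ^ 4 \<partial>circle) \<longlonglongrightarrow> (\<integral>x. (norm (\<Phi> x)) ^ 4 \<partial>circle)"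
proof -
  have finite_bound: "(\<Sum>k\<in>F. bracket s k * (norm (c k))\<^sup>2) \<le> M" if F: "finite F" for F
  proof (rule LIMSEQ_le_const2)
    show "(\<lambda>j. \<Sum>k\<in>F. bracket s k * (norm (fourier_coeff (u j) k))\<^sup>2) \<longlonglongrightarrow> (\<Sum>k\<in>F. bracket s k * (norm (c k))\<^sup>2)"
      by (intro tendsto_intros lim)
    have "(\<Sum>k\<in>F. bracket s k * (norm (fourier_coeff (u j) k))\<^sup>2) \<le> M" for j
      using finite_sum_le_has_sum[OF has_sum_sobolev_sq[OF u[of j]] F] bound[of j] by simp
    then show "\<exists>N. \<forall>j\<ge>N. (\<Sum>k\<in>F. bracket s k * (norm (fourier_coeff (u j) k))\<^sup>2) \<le> M" by blast
  qed
  have sum: "(\<lambda>k. bracket s k * (norm (c k))\<^sup>2) summable_on UNIV"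
    by (rule nonneg_bounded_partial_sums_imp_summable_on[where C = M])
       (auto intro!: eventually_finite_subsets_at_top_weakI finite_bound)
  have "(norm (c k))\<^sup>2 \<le> bracket s k * (norm (c k))\<^sup>2" for k
    using mult_right_mono[OF bracket_ge_1[of s k], of "(norm (c k))\<^sup>2"] assms(1) by simp
  then have "(\<lambda>k. (norm (c k))\<^sup>2) summable_on UNIV"
    by (rule summable_on_comparison_test[OF sum]) simp
  then obtain \<Phi> where \<Phi>: "\<Phi> \<in> L2_per" "\<And>k. fourier_coeff \<Phi> k = c k"
    using Riesz_Fischer by metis
  have \<Phi>H: "\<Phi> \<in> H_per s" using \<Phi> sum by (simp add: H_per_iff)
  have \<Phi>M: "sobolev_sq s \<Phi> \<le> M"
    using has_sum_le_finite_sums[OF has_sum_sobolev_sq[OF \<Phi>H]] finite_bound by (simp add: \<Phi>)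
  define r where "r = (1 / 4 + s) / 2"
  have r: "1 / 4 < r" "r < s" using assms(1) by (auto simp: r_def)
  define d where "d = (\<lambda>j x. u j x - \<Phi> x)"
  have d: "d j \<in> H_per s" for j unfolding d_def by (intro H_per_diff u \<Phi>H)
  \<comment> \<open>From \<open>|a - b|\<^sup>2 \<le> 2 |a|\<^sup>2 + 2 |b|\<^sup>2\<close>, since the bound \<open>M\<close> passes to the limit \<open>\<Phi>\<close>.\<close>
  have dM: "sobolev_sq s (d j) \<le> 4 * M" for j
    using sobolev_sq_diff[OF u[of j] \<Phi>H] bound[of j] \<Phi>M unfolding d_def by linarith
  have "(\<lambda>j. fourier_coeff (d j) k) \<longlonglongrightarrow> 0" for k
  proof -
    have "fourier_coeff (d j) k = fourier_coeff (u j) k - c k" for j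
      unfolding d_def using u \<Phi>H
      by (subst fourier_coeff_diff) 
         (auto simp: \<Phi> intro: square_integrable_imp_integrable H_per_imp_square_integrable)
    then show ?thesis using LIM_zero[OF lim[of k]] by simp
  qed
  then have d0: "(\<lambda>j. sobolev_sq r (d j)) \<longlonglongrightarrow> 0"
    by (intro sobolev_sq_tendsto_0_of_coeffs[OF d dM r(2)])
  obtain C where C: "C \<ge> 0"
    "\<And>f g. f \<in> H_per r \<Longrightarrow> g \<in> H_per r \<Longrightarrow> square_integrable (\<lambda>x. f x * g x)"
    "\<And>f g. f \<in> H_per r \<Longrightarrow> g \<in> H_per r \<Longrightarrow> 
       (\<integral>x. (norm (f x * g x))\<^sup>2 \<partial>circle) \<le> C * sobolev_sq r f * sobolev_sq r g"
    using product_estimate[OF r(1)] by blast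
  have Hr: "f \<in> H_per s \<Longrightarrow> f \<in> H_per r" for f using H_per_mono r(2) by (meson less_imp_le)
  have sq_bound: "(\<integral>x. (norm (u j x * u j x - \<Phi> x * \<Phi> x))\<^sup>2 \<partial>circle) \<le> C * (4 * M) * sobolev_sq r (d j)" for j
  proof -
    let ?v = "\<lambda>x. u j x + \<Phi> x"
    have v: "?v \<in> H_per s" by (intro H_per_add u \<Phi>H)
    have "sobolev_sq r ?v \<le> sobolev_sq s ?v" using sobolev_sq_mono[OF v] r(2) by simp
    also have "\<dots> \<le> 4 * M" using sobolev_sq_add[OF u[of j] \<Phi>H] bound[of j] \<Phi>M by linarith
    finally have vM: "sobolev_sq r ?v \<le> 4 * M" .
    have "(\<integral>x. (norm (u j x * u j x - \<Phi> x * \<Phi> x))\<^sup>2 \<partial>circle) = (\<integral>x. (norm (d j x * ?v x))\<^sup>2 \<partial>circle)"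
      by (simp add: d_def algebra_simps)
    also have "\<dots> \<le> C * sobolev_sq r (d j) * sobolev_sq r ?v"
      by (intro C Hr d v)
    also have "\<dots> \<le> C * sobolev_sq r (d j) * (4 * M)"
      using C(1) vM by (intro mult_left_mono) auto
    finally show ?thesis by (simp add: mult_ac)
  qed
  have "(\<lambda>j. \<integral>x. (norm (u j x * u j x - \<Phi> x * \<Phi> x))\<^sup>2 \<partial>circle) \<longlonglongrightarrow> 0"
  proof (rule tendsto_sandwich[OF _ _ tendsto_const])
    show "(\<lambda>j. C * (4 * M) * sobolev_sq r (d j)) \<longlonglongrightarrow> 0"
      using d0 by (rule tendsto_mult_right_zero)
  qed (use sq_bound in auto)
  then have "(\<lambda>j. \<integral>x. (norm (u j x * u j x))\<^sup>2 \<partial>circle) \<longlonglongrightarrow> (\<integral>x. (norm (\<Phi> x * \<Phi> x))\<^sup>2 \<partial>circle)"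
    by (intro integral_norm_sq_tendsto C Hr u \<Phi>H)
  moreover have "(norm (z * z))\<^sup>2 = (norm z) ^ 4" for z :: complex
    by (simp add: norm_mult power4_eq_xxxx power2_eq_square)
  ultimately show thesis using that[OF \<Phi>H \<Phi>(2)] by simp
qed

section \<open>The energy as a Fourier multiplier form\<close>

text \<open>The Fourier multiplier of \<open>(-\<Delta>)\<^sup>s + \<omega>\<close>. At \<open>k = 0\<close> the power is \<open>0\<close>, so the value there is \<open>\<omega>\<close>.\<close>

definition symbol :: "real \<Rightarrow> real \<Rightarrow> int \<Rightarrow> real" where
  "symbol s \<omega> k = \<bar>real_of_int k\<bar> powr (2 * s) + \<omega>"

lemma abs_powr_le_bracket:
  assumes "0 < s"
  shows "\<bar>real_of_int k\<bar> powr (2 * s) \<le> bracket s k"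
proof -
  have "\<bar>real_of_int k\<bar> powr (2 * s) = ((real_of_int k)\<^sup>2) powr s"
  proof -
    have "\<bar>real_of_int k\<bar> powr 2 = (real_of_int k)\<^sup>2" by (cases "k = 0") auto
    then show ?thesis using powr_powr[of "\<bar>real_of_int k\<bar>" 2 s] by simp
  qed
  also have "\<dots> \<le> bracket s k"
    unfolding bracket_def using assms by (intro powr_mono2) auto
  finally show ?thesis .
qed

text \<open>The energy controls the full Sobolev norm: for \<open>k \<noteq> 0\<close> one has \<open>1 + k\<^sup>2 \<le> 2 k\<^sup>2\<close>, which costs a factor
\<open>2\<^sup>s \<le> 2\<close>, and for \<open>k = 0\<close> the term \<open>\<omega>\<close> is available.\<close>

lemma bracket_le_symbol:
  assumes "0 < s" "s \<le> 1" "\<omega> > 0"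
  shows "bracket s k \<le> max 2 (1 / \<omega>) * symbol s \<omega> k"
proof (cases "k = 0")
  case True
  have "1 \<le> max 2 (1 / \<omega>) * \<omega>"
    using mult_right_mono[of "1 / \<omega>" "max 2 (1 / \<omega>)" \<omega>] assms by simp
  then show ?thesis using True assms by (simp add: bracket_def symbol_def)
next
  case False
  let ?x = "\<bar>real_of_int k\<bar>"
  have x: "?x \<ge> 1" using False by linarith
  have "bracket s k \<le> (2 * ?x\<^sup>2) powr s"
    unfolding bracket_def using assms x power_mono[OF x, of 2] by (intro powr_mono2) auto
  also have "\<dots> = 2 powr s * ?x powr (2 * s)"
  proof -
    have "?x powr 2 = ?x\<^sup>2" using x by (intro powr_numeral) linarith
    then show ?thesis using powr_powr[of ?x 2 s] by (simp add: powr_mult)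
  qed
  also have "\<dots> \<le> 2 powr 1 * ?x powr (2 * s)"
    using assms by (intro mult_right_mono powr_mono) auto
  also have "\<dots> \<le> max 2 (1 / \<omega>) * symbol s \<omega> k"
    unfolding symbol_def using assms by (intro mult_mono) auto
  finally show ?thesis .
qed

text \<open>For \<open>u\<close> in \<open>H\<^sup>s\<close>, the coefficients of \<open>u\<close> multiplied by \<open>|k|\<^sup>s\<close> are square summable. By Riesz--Fischer the
choice in \<^const>\<open>frac_laplacian\<close> is therefore made from a nonempty set, and Parseval's identity
evaluates the energy.\<close>

lemma has_sum_energy:
  assumes u: "u \<in> H_per s" and "0 < s"
  shows "((\<lambda>k. symbol s \<omega> k * (norm (fourier_coeff u k))\<^sup>2) has_sum (energy s \<omega> u / pi)) UNIV"
proof -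
  let ?c = "frac_laplacian_coeff (s / 2) u"
  have c: "(norm (?c k))\<^sup>2 = \<bar>real_of_int k\<bar> powr (2 * s) * (norm (fourier_coeff u k))\<^sup>2" for k
    by (simp add: frac_laplacian_coeff_def norm_mult power_mult_distrib power2_eq_square flip: powr_add)
  have "(\<lambda>k. (norm (?c k))\<^sup>2) summable_on UNIV"
    by (rule summable_on_comparison_test[OF has_sum_imp_summable[OF has_sum_sobolev_sq[OF u]]])
       (auto simp: c intro!: mult_right_mono abs_powr_le_bracket \<open>0 < s\<close>)
  then obtain h where "h \<in> L2_per" "\<And>k. fourier_coeff h k = ?c k"
    using Riesz_Fischer by metis
  then have ex: "\<exists>h. h \<in> L2_per \<and> (\<forall>k. fourier_coeff h k = ?c k)" by blast
  let ?F = "frac_laplacian (s / 2) u"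
  from someI_ex[OF ex] have "?F \<in> L2_per \<and> (\<forall>k. fourier_coeff ?F k = ?c k)"
    unfolding frac_laplacian_def .
  then have F: "?F \<in> L2_per" and Fc: "\<And>k. fourier_coeff ?F k = ?c k" by auto
  have sq: "square_integrable ?F" "square_integrable u"
    using F u by (auto intro: L2_per_imp_square_integrable H_per_imp_square_integrable)
  have "energy s \<omega> u = 1 / 2 * (\<integral>x. (norm (?F x))\<^sup>2 + \<omega> * (norm (u x))\<^sup>2 \<partial>circle)"
    unfolding energy_def integral_circle ..
  also have "\<dots> = 1 / 2 * ((\<integral>x. (norm (?F x))\<^sup>2 \<partial>circle) + \<omega> * (\<integral>x. (norm (u x))\<^sup>2 \<partial>circle))"
    using sq by (simp add: square_integrable_def)
  finally have E: "energy s \<omega> u / pi = (\<integral>x. (norm (?F x))\<^sup>2 \<partial>circle) / (2 * pi) + \<omega> * ((\<integral>x. (norm (u x))\<^sup>2 \<partial>circle) / (2 * pi))"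
    by (simp add: field_simps)
  have "((\<lambda>k. (norm (?c k))\<^sup>2 + \<omega> * (norm (fourier_coeff u k))\<^sup>2) has_sum (energy s \<omega> u / pi)) UNIV"
    unfolding E Fc[symmetric] by (intro has_sum_add has_sum_cmult_right Parseval sq)
  then show ?thesis unfolding c symbol_def by (simp add: algebra_simps)
qed

lemma energy_nonneg:
  assumes "u \<in> H_per s" "0 < s" "0 < \<omega>"
  shows "0 \<le> energy s \<omega> u"
proof -
  have "0 \<le> energy s \<omega> u / pi"
    by (rule has_sum_nonneg[OF has_sum_energy[OF assms(1,2)]]) (use assms in \<open>simp add: symbol_def\<close>)
  then show ?thesis using pi_gt_zero by (auto simp: zero_le_divide_iff)
qed

lemma energy_cmult:
  assumes "u \<in> H_per s" "0 < s"
  shows "energy s \<omega> (\<lambda>x. a * u x) = (norm a)\<^sup>2 * energy s \<omega> u"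
proof -
  have "((\<lambda>k. (norm a)\<^sup>2 * (symbol s \<omega> k * (norm (fourier_coeff u k))\<^sup>2)) has_sum ((norm a)\<^sup>2 * (energy s \<omega> u / pi))) UNIV"
    by (intro has_sum_cmult_right has_sum_energy assms)
  moreover have "((\<lambda>k. (norm a)\<^sup>2 * (symbol s \<omega> k * (norm (fourier_coeff u k))\<^sup>2)) has_sum (energy s \<omega> (\<lambda>x. a * u x) / pi)) UNIV"
    using has_sum_energy[OF H_per_cmult[OF assms(1), of a] assms(2), of \<omega>]
    by (simp add: fourier_coeff_cmult norm_mult power_mult_distrib mult_ac)
  ultimately have "(norm a)\<^sup>2 * (energy s \<omega> u / pi) = energy s \<omega> (\<lambda>x. a * u x) / pi"
    by (rule has_sum_unique)
  then show ?thesis by simp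
qed

lemma sobolev_sq_le_energy:
  assumes "u \<in> H_per s" "0 < s" "s \<le> 1" "0 < \<omega>"
  shows "sobolev_sq s u \<le> max 2 (1 / \<omega>) * (energy s \<omega> u / pi)"
proof (rule has_sum_mono[OF has_sum_sobolev_sq[OF assms(1)] has_sum_cmult_right[OF has_sum_energy[OF assms(1,2)]]])
  show "bracket s k * (norm (fourier_coeff u k))\<^sup>2 \<le> max 2 (1 / \<omega>) * (symbol s \<omega> k * (norm (fourier_coeff u k))\<^sup>2)" for k
    using mult_right_mono[OF bracket_le_symbol[OF assms(2-4)], of "(norm (fourier_coeff u k))\<^sup>2" k]
    by (simp add: mult.assoc)
qed

text \<open>Perturbing a single frequency changes a single term of the energy series. Such perturbations suffice
to test every Fourier coefficient of the Euler--Lagrange equation.\<close>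

lemma energy_add_character:
  assumes u: "u \<in> H_per s" and "0 < s"
  shows "(\<lambda>x. u x + a * character k x) \<in> H_per s"
    and "energy s \<omega> (\<lambda>x. u x + a * character k x) = energy s \<omega> u + 
      pi * symbol s \<omega> k * (2 * Re (fourier_coeff u k * cnj a) + (norm a)\<^sup>2)"
proof -
  have "(\<lambda>m. bracket s m * (norm (fourier_coeff (character k) m))\<^sup>2) summable_on UNIV"
    by (rule has_sum_imp_summable[OF has_sum_finite_neutralI[of "{k}"]]) (auto simp: fourier_coeff_character)
  then have e: "character k \<in> H_per s"
    by (auto simp: H_per_iff L2_per_iff character_periodic square_integrable_character)
  then show v: "(\<lambda>x. u x + a * character k x) \<in> H_per s"
    by (intro H_per_add u H_per_cmult)
  let ?v = "\<lambda>x. u x + a * character k x"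
  let ?D = "symbol s \<omega> k * (2 * Re (fourier_coeff u k * cnj a) + (norm a)\<^sup>2)"
  have coeff: "fourier_coeff ?v m = fourier_coeff u m + (if k = m then a else 0)" for m
    using u by (subst fourier_coeff_add) 
     (auto simp: fourier_coeff_cmult fourier_coeff_character integrable_character 
        intro: square_integrable_imp_integrable H_per_imp_square_integrable)
  have "((\<lambda>m. symbol s \<omega> m * (norm (fourier_coeff u m))\<^sup>2 + (if m = k then ?D else 0)) 
      has_sum (energy s \<omega> u / pi + ?D)) UNIV"
    by (intro has_sum_add has_sum_energy assms has_sum_finite_neutralI[of "{k}"]) auto
  moreover have "symbol s \<omega> m * (norm (fourier_coeff ?v m))\<^sup>2 
      = symbol s \<omega> m * (norm (fourier_coeff u m))\<^sup>2 + (if m = k then ?D else 0)" for m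
    by (auto simp: coeff norm_add_sq_complex algebra_simps)
  ultimately have "energy s \<omega> ?v / pi = energy s \<omega> u / pi + ?D"
    using has_sum_unique has_sum_energy[OF v \<open>0 < s\<close>, of \<omega>] by simp
  then show "energy s \<omega> ?v = energy s \<omega> u + pi * symbol s \<omega> k * (2 * Re (fourier_coeff u k * cnj a) + (norm a)\<^sup>2)"
    by (simp add: field_simps)
qed

section \<open>Existence of a minimizer\<close>

lemma Re_of_real_mult: "Re (of_real r * z) = r * Re z"
  by simp

lemma norm_mult_self_sq: "(norm (z * z :: complex))\<^sup>2 = (norm z) ^ 4"
  by (simp add: norm_mult power4_eq_xxxx power2_eq_square)

lemma square_integrable_mult_self:
  assumes "1 / 4 < s" "u \<in> H_per s"
  shows "square_integrable (\<lambda>x. u x * u x)"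
  using product_estimate[OF assms(1)] assms(2) by blast

lemma integrable_norm_power4:
  assumes "1 / 4 < s" "u \<in> H_per s"
  shows "integrable circle (\<lambda>x. (norm (u x)) ^ 4)"
  using square_integrable_mult_self[OF assms] by (simp add: square_integrable_def norm_mult_self_sq)

lemma constraint_set_iff:
  assumes "1 / 4 < s"
  shows "u \<in> constraint_set s \<tau> \<longleftrightarrow> u \<in> H_per s \<and> (\<integral>x. (norm (u x)) ^ 4 \<partial>circle) = \<tau>"
  using integrable_norm_power4[OF assms, of u]
  unfolding constraint_set_def integrable_circle_iff integral_circle by blast

lemma normalized_in_constraint_set:
  assumes "1 / 4 < s" "\<tau> > 0" and u: "u \<in> H_per s" and pos: "(\<integral>x. (norm (u x)) ^ 4 \<partial>circle) > 0"
  shows "(\<lambda>x. of_real (root 4 (\<tau> / (\<integral>x. (norm (u x)) ^ 4 \<partial>circle))) * u x) \<in> constraint_set s \<tau>"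
proof -
  let ?N = "\<integral>x. (norm (u x)) ^ 4 \<partial>circle"
  have "root 4 (\<tau> / ?N) ^ 4 = \<tau> / ?N"
    using assms by (intro real_root_pow_pos2) auto
  then have "(\<integral>x. (norm (of_real (root 4 (\<tau> / ?N)) * u x)) ^ 4 \<partial>circle) = \<tau>"
    using pos by (simp add: norm_mult power_mult_distrib)
  then show ?thesis using u assms(1) by (simp add: constraint_set_iff H_per_cmult)
qed

lemma constraint_set_nonempty:
  assumes "1 / 4 < s" "\<tau> > 0"
  shows "constraint_set s \<tau> \<noteq> {}"
proof -
  have "(\<lambda>x. 0 + 1 * character 0 x) \<in> H_per s"
  proof (rule energy_add_character)
    have "fourier_coeff (\<lambda>x. 0) k = 0" for k by (simp add: fourier_coeff_circle)
    then show "(\<lambda>x. 0) \<in> H_per s" by (simp add: H_per_iff L2_per_iff square_integrable_def)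
  qed (use assms in simp)
  then have "(\<lambda>x. 1) \<in> H_per s" by simp
  from normalized_in_constraint_set[OF assms this] show ?thesis
    by (auto simp: measure_circle)
qed

lemma bdd_below_energy:
  assumes "1 / 4 < s" "0 < \<omega>"
  shows "bdd_below (energy s \<omega> ` constraint_set s \<tau>)"
  using assms by (intro bdd_belowI2[of _ 0] energy_nonneg) (auto simp: constraint_set_iff)

lemma min_energy_le:
  assumes "1 / 4 < s" "0 < \<omega>" "u \<in> constraint_set s \<tau>"
  shows "min_energy s \<omega> \<tau> \<le> energy s \<omega> u"
  unfolding min_energy_def by (intro cINF_lower bdd_below_energy assms)

lemma min_energy_nonneg:
  assumes "1 / 4 < s" "0 < \<omega>" "0 < \<tau>"
  shows "0 \<le> min_energy s \<omega> \<tau>"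
  unfolding min_energy_def using assms
  by (intro cINF_greatest constraint_set_nonempty energy_nonneg) (auto simp: constraint_set_iff)

text \<open>Bolzano--Weierstrass at each frequency, followed by a diagonal argument over an enumeration of the
integers.\<close>

lemma bounded_coefficients_convergent_subsequence:
  fixes a :: "nat \<Rightarrow> int \<Rightarrow> complex"
  assumes bound: "\<And>j k. norm (a j k) \<le> B"
  obtains \<sigma> c where "strict_mono \<sigma>" "\<And>k. (\<lambda>j. a (\<sigma> j) k) \<longlonglongrightarrow> c k"
proof -
  define P where "P = (\<lambda>n \<sigma>. convergent (\<lambda>j. a (\<sigma> j) (int_decode n)))"
  interpret subseqs P
  proof
    fix n and \<sigma> :: "nat \<Rightarrow> nat"
    have "bounded (range (\<lambda>j. a (\<sigma> j) (int_decode n)))"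
      by (rule boundedI) (use bound in auto)
    from bounded_imp_convergent_subsequence[OF this]
    show "\<exists>r. strict_mono r \<and> P n (\<sigma> \<circ> r)"
      by (auto simp: P_def o_def convergent_def)
  qed
  have "convergent (\<lambda>j. a (diagseq j) k)" for k
  proof -
    let ?n = "int_encode k"
    have "P ?n (diagseq \<circ> ((+) (Suc ?n)))"
    proof (rule diagseq_holds)
      show "P n (s \<circ> r)" if "strict_mono r" "P n s" for r s n
        using convergent_subseq_convergent[of "\<lambda>j. a (s j) (int_decode n)" r] that by (simp add: P_def o_def)
    qed
    then have "convergent (\<lambda>j. a (diagseq (j + Suc ?n)) k)" by (simp add: P_def o_def add.commute)
    then show ?thesis using convergent_ignore_initial_segment by (rule iffD1[rotated])
  qed
  then have "\<And>k. (\<lambda>j. a (diagseq j) k) \<longlonglongrightarrow> lim (\<lambda>j. a (diagseq j) k)"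
    by (simp add: convergent_LIMSEQ_iff)
  then show thesis by (rule that[OF subseq_diagseq])
qed

text \<open>The direct method. A minimizing sequence is bounded in \<open>H\<^sup>s\<close>, a subsequence has convergent
coefficients, compactness keeps the limit in the constraint set, and the energy is lower
semicontinuous because each of its finite partial sums passes to the limit.\<close>

theorem minimizer_exists:
  assumes "1 / 4 < s" "s \<le> 1" "\<tau> > 0" "\<omega> > 0"
  obtains \<Phi> where "\<Phi> \<in> constraint_set s \<tau>" "energy s \<omega> \<Phi> = min_energy s \<omega> \<tau>"
proof -
  define \<Gamma> where "\<Gamma> = min_energy s \<omega> \<tau>"
  have s0: "0 < s" using assms by simp
  have "\<exists>u\<in>constraint_set s \<tau>. energy s \<omega> u < \<Gamma> + 1 / real (Suc j)" for j
  proof -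
    have "(INF u\<in>constraint_set s \<tau>. energy s \<omega> u) < \<Gamma> + 1 / real (Suc j)"
      by (simp add: \<Gamma>_def min_energy_def)
    then show ?thesis
      using cINF_less_iff[OF constraint_set_nonempty[OF assms(1,3)] bdd_below_energy[OF assms(1,4)]] by blast
  qed
  then obtain v where v: "\<And>j. v j \<in> constraint_set s \<tau>" "\<And>j. energy s \<omega> (v j) < \<Gamma> + 1 / real (Suc j)"
    by metis
  have vH: "v j \<in> H_per s" and vN: "(\<integral>x. (norm (v j x)) ^ 4 \<partial>circle) = \<tau>" for j
    using v(1)[of j] assms(1) by (auto simp: constraint_set_iff)
  define M where "M = max 2 (1 / \<omega>) * ((\<Gamma> + 1) / pi)"
  have vM: "sobolev_sq s (v j) \<le> M" for j
  proof -
    have "energy s \<omega> (v j) \<le> \<Gamma> + 1"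
      using v(2)[of j] by (rule order_trans[OF less_imp_le]) (simp add: field_simps)
    then have "max 2 (1 / \<omega>) * (energy s \<omega> (v j) / pi) \<le> M"
      unfolding M_def by (intro mult_left_mono divide_right_mono) auto
    then show ?thesis using sobolev_sq_le_energy[OF vH[of j] s0 assms(2,4)] by linarith
  qed
  have coeff_bound: "norm (fourier_coeff (v j) k) \<le> sqrt M" for j k
  proof (rule real_le_rsqrt)
    have "(norm (fourier_coeff (v j) k))\<^sup>2 \<le> bracket s k * (norm (fourier_coeff (v j) k))\<^sup>2"
      using mult_right_mono[OF bracket_ge_1[of s k], of "(norm (fourier_coeff (v j) k))\<^sup>2"] s0 by simp
    also have "\<dots> \<le> sobolev_sq s (v j)"
      using finite_sum_le_has_sum[OF has_sum_sobolev_sq[OF vH[of j]], of "{k}"] by simp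
    finally show "(norm (fourier_coeff (v j) k))\<^sup>2 \<le> M" using vM[of j] by linarith
  qed
  obtain \<sigma> c where \<sigma>: "strict_mono \<sigma>" "\<And>k. (\<lambda>j. fourier_coeff (v (\<sigma> j)) k) \<longlonglongrightarrow> c k"
    using bounded_coefficients_convergent_subsequence[of "\<lambda>j. fourier_coeff (v j)", OF coeff_bound] by blast
  obtain \<Phi> where \<Phi>: "\<Phi> \<in> H_per s" "\<And>k. fourier_coeff \<Phi> k = c k"
    "(\<lambda>j. \<integral>x. (norm (v (\<sigma> j) x)) ^ 4 \<partial>circle) \<longlonglongrightarrow> (\<integral>x. (norm (\<Phi> x)) ^ 4 \<partial>circle)"
    using compact_embedding_L4[OF assms(1) vH vM \<sigma>(2)] by blast
  have \<Phi>Y: "\<Phi> \<in> constraint_set s \<tau>"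
    using \<Phi>(1,3) assms(1) by (simp add: constraint_set_iff vN LIMSEQ_const_iff)
  have "energy s \<omega> \<Phi> / pi \<le> \<Gamma> / pi"
  proof (rule has_sum_le_finite_sums[OF has_sum_energy[OF \<Phi>(1) s0]])
    fix F :: "int set" assume F: "finite F"
    have lim: "(\<lambda>j. \<Sum>k\<in>F. symbol s \<omega> k * (norm (fourier_coeff (v (\<sigma> j)) k))\<^sup>2) \<longlonglongrightarrow>
        (\<Sum>k\<in>F. symbol s \<omega> k * (norm (fourier_coeff \<Phi> k))\<^sup>2)"
      unfolding \<Phi>(2) by (intro tendsto_intros \<sigma>)
    have "(\<lambda>j. (\<Gamma> + 1 / real (Suc j)) / pi) \<longlonglongrightarrow> (\<Gamma> + 0) / pi"
      by (intro tendsto_intros LIMSEQ_Suc[OF lim_1_over_n]) simp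
    then have lim': "(\<lambda>j. (\<Gamma> + 1 / real (Suc (\<sigma> j))) / pi) \<longlonglongrightarrow> \<Gamma> / pi"
      using LIMSEQ_subseq_LIMSEQ[OF _ \<sigma>(1)] by (fastforce simp: o_def)
    have "(\<Sum>k\<in>F. symbol s \<omega> k * (norm (fourier_coeff (v j) k))\<^sup>2) \<le> (\<Gamma> + 1 / real (Suc j)) / pi" for j
    proof -
      have "(\<Sum>k\<in>F. symbol s \<omega> k * (norm (fourier_coeff (v j) k))\<^sup>2) \<le> energy s \<omega> (v j) / pi"
        using assms(4) by (intro finite_sum_le_has_sum[OF has_sum_energy[OF vH s0]] F) (auto simp: symbol_def)
      also have "\<dots> \<le> (\<Gamma> + 1 / real (Suc j)) / pi"
        using v(2)[of j] by (intro divide_right_mono) auto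
      finally show ?thesis .
    qed
    then show "(\<Sum>k\<in>F. symbol s \<omega> k * (norm (fourier_coeff \<Phi> k))\<^sup>2) \<le> \<Gamma> / pi"
      by (intro LIMSEQ_le[OF lim lim']) blast
  qed
  then have "energy s \<omega> \<Phi> \<le> \<Gamma>" by (simp add: divide_le_cancel)
  with min_energy_le[OF assms(1,4) \<Phi>Y] have "energy s \<omega> \<Phi> = min_energy s \<omega> \<tau>"
    by (simp add: \<Gamma>_def)
  with \<Phi>Y show thesis by (rule that)
qed

text \<open>The infimum is attained, and a function of zero energy has a vanishing \<open>L\<^sup>4\<close> norm by the product
estimate, whereas the constraint requires \<open>\<tau> > 0\<close>.\<close>

lemma min_energy_pos:
  assumes "1 / 4 < s" "s \<le> 1" "\<tau> > 0" "\<omega> > 0"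
  shows "min_energy s \<omega> \<tau> > 0"
proof -
  obtain \<Phi> where \<Phi>: "\<Phi> \<in> constraint_set s \<tau>" "energy s \<omega> \<Phi> = min_energy s \<omega> \<tau>"
    using minimizer_exists[OF assms] .
  have H: "\<Phi> \<in> H_per s" and N: "(\<integral>x. (norm (\<Phi> x)) ^ 4 \<partial>circle) = \<tau>"
    using \<Phi>(1) assms(1) by (auto simp: constraint_set_iff)
  obtain C where C: "(\<integral>x. (norm (\<Phi> x * \<Phi> x))\<^sup>2 \<partial>circle) \<le> C * sobolev_sq s \<Phi> * sobolev_sq s \<Phi>"
  proof (rule product_estimate[OF assms(1)])
    fix C assume "\<And>f g. f \<in> H_per s \<Longrightarrow> g \<in> H_per s \<Longrightarrow> 
       (\<integral>x. (norm (f x * g x))\<^sup>2 \<partial>circle) \<le> C * sobolev_sq s f * sobolev_sq s g"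
    from this[OF H H] show thesis by (rule that)
  qed
  have "min_energy s \<omega> \<tau> \<noteq> 0"
  proof
    assume "min_energy s \<omega> \<tau> = 0"
    then have "sobolev_sq s \<Phi> \<le> 0"
      using sobolev_sq_le_energy[OF H _ assms(2,4)] assms(1) \<Phi>(2) by simp
    then have "sobolev_sq s \<Phi> = 0" using sobolev_sq_nonneg[of s \<Phi>] by linarith
    then show False using C N assms(3) by (simp add: norm_mult_self_sq)
  qed
  then show ?thesis using min_energy_nonneg[OF assms(1,4,3)] by linarith
qed

section \<open>The Euler--Lagrange equation\<close>

text \<open>Rescaling to the constraint set turns minimality into an inequality between quantities of degree four
on all of \<open>H\<^sup>s\<close>. It is an equality at a minimizer, so that the variations in the Euler--Lagrange
argument need not respect the constraint.\<close>

lemma homogeneous_energy_inequality: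
  assumes "1 / 4 < s" "\<tau> > 0" "\<omega> > 0" and u: "u \<in> H_per s"
  shows "(min_energy s \<omega> \<tau>)\<^sup>2 * (\<integral>x. (norm (u x)) ^ 4 \<partial>circle) \<le> \<tau> * (energy s \<omega> u)\<^sup>2"
proof (cases "(\<integral>x. (norm (u x)) ^ 4 \<partial>circle) = 0")
  case False
  define N where "N = (\<integral>x. (norm (u x)) ^ 4 \<partial>circle)"
  have "N \<ge> 0" unfolding N_def by (intro Bochner_Integration.integral_nonneg) simp
  then have N: "N > 0" using False unfolding N_def by linarith
  define a where "a = root 4 (\<tau> / N)"
  have a4: "a ^ 4 = \<tau> / N"
    unfolding a_def using assms N by (intro real_root_pow_pos2) auto
  have "(\<lambda>x. of_real a * u x) \<in> constraint_set s \<tau>"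
    using normalized_in_constraint_set[OF assms(1,2) u] N unfolding N_def a_def by simp
  then have "min_energy s \<omega> \<tau> \<le> energy s \<omega> (\<lambda>x. of_real a * u x)"
    by (intro min_energy_le assms)
  also have "\<dots> = a\<^sup>2 * energy s \<omega> u"
    using assms by (subst energy_cmult) auto
  finally have "(min_energy s \<omega> \<tau>)\<^sup>2 \<le> (a\<^sup>2 * energy s \<omega> u)\<^sup>2"
    by (intro power_mono min_energy_nonneg assms)
  also have "\<dots> = (\<tau> / N) * (energy s \<omega> u)\<^sup>2"
    by (simp add: power_mult_distrib flip: a4 power_mult)
  finally show ?thesis using N by (simp add: N_def field_simps)
qed (use assms in simp)

lemma norm_power4_expansion:
  fixes z w :: complex and t :: real
  shows "(norm (z + of_real t * w)) ^ 4 = (norm z) ^ 4 + t * (4 * Re (of_real ((norm z)\<^sup>2) * z * cnj w))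
    + t\<^sup>2 * (4 * (Re (z * cnj w))\<^sup>2 + 2 * ((norm w)\<^sup>2 * (norm z)\<^sup>2)) 
    + t ^ 3 * (4 * (norm w)\<^sup>2 * Re (z * cnj w)) + t ^ 4 * (norm w) ^ 4"
proof -
  have "(norm (z + of_real t * w))\<^sup>2 = (norm z)\<^sup>2 + t * (2 * Re (z * cnj w)) + t\<^sup>2 * (norm w)\<^sup>2"
    by (simp add: norm_add_sq_complex norm_mult power_mult_distrib algebra_simps)
  moreover have "(norm (z + of_real t * w)) ^ 4 = ((norm (z + of_real t * w))\<^sup>2)\<^sup>2"
    by simp
  moreover have "Re (of_real ((norm z)\<^sup>2) * z * cnj w) = (norm z)\<^sup>2 * Re (z * cnj w)"
    by (simp only: mult.assoc Re_of_real_mult)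
  ultimately show ?thesis
    by (simp add: power4_eq_xxxx power3_eq_cube power2_eq_square algebra_simps)
qed

text \<open>Along a line, the \<open>L\<^sup>4\<close> functional is a quartic polynomial in the parameter. Its linear
coefficient carries the Fourier coefficient of the cubic term.\<close>

lemma integral_norm_power4_add_character:
  assumes "1 / 4 < s" and u: "u \<in> H_per s"
  shows "\<exists>n2 n3 n4. \<forall>t. (\<integral>x. (norm (u x + of_real t * (z * character k x))) ^ 4 \<partial>circle) =
    (\<integral>x. (norm (u x)) ^ 4 \<partial>circle) 
    + t * (8 * pi * Re (fourier_coeff (\<lambda>x. of_real ((norm (u x))\<^sup>2) * u x) k * cnj z))
    + t\<^sup>2 * n2 + t ^ 3 * n3 + t ^ 4 * n4"
proof -
  let ?w = "\<lambda>x. z * character k x"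
  let ?q = "\<lambda>x. of_real ((norm (u x))\<^sup>2) * u x"
  have sq: "square_integrable u" using u by (rule H_per_imp_square_integrable)
  then have [measurable]: "u \<in> borel_measurable circle" by (simp add: square_integrable_def)
  have "square_integrable (\<lambda>x. of_real ((norm (u x))\<^sup>2))"
    using integrable_norm_power4[OF assms] by (simp add: square_integrable_def norm_power flip: power_mult)
  then have q: "integrable circle ?q"
    using sq by (rule integrable_mult_square_integrable)
  have cnj_w: "cnj (?w x) = cnj z * character (- k) x" for x by (simp add: cnj_character)
  have qw_eq: "?q x * cnj (?w x) = cnj z * (?q x * character (- k) x)" for x
    unfolding cnj_w by (simp only: mult_ac)
  have qw: "integrable circle (\<lambda>x. ?q x * cnj (?w x))"
    unfolding qw_eq by (intro integrable_mult_right integrable_mult_character q)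
  have qw_int: "(\<integral>x. Re (?q x * cnj (?w x)) \<partial>circle) = 2 * pi * Re (fourier_coeff ?q k * cnj z)"
  proof -
    have "(\<integral>x. Re (?q x * cnj (?w x)) \<partial>circle) = Re (\<integral>x. ?q x * cnj (?w x) \<partial>circle)"
      by (rule integral_Re[OF qw])
    also have "(\<integral>x. ?q x * cnj (?w x) \<partial>circle) = of_real (2 * pi) * (fourier_coeff ?q k * cnj z)"
      unfolding qw_eq integral_mult_right_zero integral_circle_character by (simp only: mult_ac)
    finally show ?thesis by (simp only: Re_of_real_mult)
  qed
  have uw: "integrable circle (\<lambda>x. u x * cnj (?w x))"
    by (intro integrable_mult_square_integrable sq square_integrable_cnj square_integrable_cmult square_integrable_character)
  have norm_w: "norm (?w x) = norm z" for x by (simp add: norm_mult)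
  have u2: "integrable circle (\<lambda>x. (norm (u x))\<^sup>2)" using sq by (simp add: square_integrable_def)
  have re2: "integrable circle (\<lambda>x. (Re (u x * cnj (?w x)))\<^sup>2)"
  proof (rule Bochner_Integration.integrable_bound)
    show "integrable circle (\<lambda>x. (norm z)\<^sup>2 * (norm (u x))\<^sup>2)" using u2 by simp
    show "(\<lambda>x. (Re (u x * cnj (?w x)))\<^sup>2) \<in> borel_measurable circle"
      using borel_measurable_integrable[OF integrable_Re[OF uw]] by measurable
    have "\<bar>Re (u x * cnj (?w x))\<bar>\<^sup>2 \<le> (norm (u x * cnj (?w x)))\<^sup>2" for x
      by (intro power_mono abs_Re_le_cmod) simp
    then show "AE x in circle. norm ((Re (u x * cnj (?w x)))\<^sup>2) \<le> norm ((norm z)\<^sup>2 * (norm (u x))\<^sup>2)"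
      by (simp add: norm_mult power_mult_distrib mult.commute)
  qed
  define T2 T3 where "T2 = (\<lambda>x. 4 * (Re (u x * cnj (?w x)))\<^sup>2 + 2 * ((norm (?w x))\<^sup>2 * (norm (u x))\<^sup>2))"
    and "T3 = (\<lambda>x. 4 * (norm (?w x))\<^sup>2 * Re (u x * cnj (?w x)))"
  have T2: "integrable circle T2" unfolding T2_def norm_w using re2 u2
    by (intro Bochner_Integration.integrable_add integrable_mult_right)
  have T3: "integrable circle T3" unfolding T3_def norm_w using uw by (intro integrable_mult_right integrable_Re)
  have T1: "integrable circle (\<lambda>x. Re (?q x * cnj (?w x)))" using qw by (rule integrable_Re)
  have T4: "integrable circle (\<lambda>x. (norm (?w x)) ^ 4)" unfolding norm_w by simp
  have "(\<integral>x. (norm (u x + of_real t * ?w x)) ^ 4 \<partial>circle) =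
    (\<integral>x. (norm (u x)) ^ 4 \<partial>circle) + t * (8 * pi * Re (fourier_coeff ?q k * cnj z))
    + t\<^sup>2 * integral\<^sup>L circle T2 + t ^ 3 * integral\<^sup>L circle T3 + t ^ 4 * (\<integral>x. (norm (?w x)) ^ 4 \<partial>circle)" for t
  proof -
    have "(\<integral>x. (norm (u x + of_real t * ?w x)) ^ 4 \<partial>circle) = (\<integral>x. (norm (u x)) ^ 4 
      + t * (4 * Re (?q x * cnj (?w x))) + t\<^sup>2 * T2 x + t ^ 3 * T3 x + t ^ 4 * (norm (?w x)) ^ 4 \<partial>circle)"
      unfolding norm_power4_expansion T2_def T3_def ..
    also have "\<dots> = (\<integral>x. (norm (u x)) ^ 4 \<partial>circle) + t * (4 * (2 * pi * Re (fourier_coeff ?q k * cnj z)))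
      + t\<^sup>2 * integral\<^sup>L circle T2 + t ^ 3 * integral\<^sup>L circle T3 + t ^ 4 * (\<integral>x. (norm (?w x)) ^ 4 \<partial>circle)"
      by (simp only: Bochner_Integration.integral_add Bochner_Integration.integrable_add integral_mult_right_zero 
          integrable_mult_right T1 T2 T3 T4 integrable_norm_power4[OF assms] qw_int)
    finally show ?thesis by simp
  qed
  then show ?thesis by blast
qed

text \<open>For \<open>u = \<Phi> + t z e\<^sup>i\<^sup>k\<^sup>x\<close>, the difference of the two sides of the homogeneous inequality is a polynomial
in the real variable \<open>t\<close>. It is nonnegative and vanishes at \<open>t = 0\<close>, so its derivative there is zero.
Testing all complex \<open>z\<close> would give the equation at frequency \<open>k\<close>; testing the single \<open>z\<close> equal to the
defect of that equation already gives \<open>|z|\<^sup>2 = 0\<close>.\<close>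

theorem Euler_Lagrange:
  assumes "1 / 4 < s" "s \<le> 1" "\<tau> > 0" "\<omega> > 0"
    and \<Phi>: "\<Phi> \<in> constraint_set s \<tau>" "energy s \<omega> \<Phi> = min_energy s \<omega> \<tau>"
  shows "of_real (\<tau> * symbol s \<omega> k) * fourier_coeff \<Phi> k 
    = of_real (2 * min_energy s \<omega> \<tau>) * fourier_coeff (\<lambda>x. of_real ((norm (\<Phi> x))\<^sup>2) * \<Phi> x) k"
proof -
  define \<Gamma> where "\<Gamma> = min_energy s \<omega> \<tau>"
  have \<Gamma>: "\<Gamma> > 0" unfolding \<Gamma>_def using assms by (intro min_energy_pos)
  have s0: "0 < s" using assms by simp
  have H: "\<Phi> \<in> H_per s" and N: "(\<integral>x. (norm (\<Phi> x)) ^ 4 \<partial>circle) = \<tau>"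
    using \<Phi>(1) assms(1) by (auto simp: constraint_set_iff)
  define c q where "c = fourier_coeff \<Phi> k" and "q = fourier_coeff (\<lambda>x. of_real ((norm (\<Phi> x))\<^sup>2) * \<Phi> x) k"
  define z where "z = of_real (\<tau> * symbol s \<omega> k) * c - of_real (2 * \<Gamma>) * q"
  obtain n2 n3 n4 where expand: "\<forall>t. (\<integral>x. (norm (\<Phi> x + of_real t * (z * character k x))) ^ 4 \<partial>circle) =
    \<tau> + t * (8 * pi * Re (q * cnj z)) + t\<^sup>2 * n2 + t ^ 3 * n3 + t ^ 4 * n4"
    using integral_norm_power4_add_character[OF assms(1) H, of z k] unfolding N q_def by blast
  define E where "E = (\<lambda>t. \<Gamma> + t * (2 * pi * symbol s \<omega> k * Re (c * cnj z)) + t\<^sup>2 * (pi * symbol s \<omega> k * (norm z)\<^sup>2))"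
  define h where "h = (\<lambda>t. \<tau> * (E t)\<^sup>2 - \<Gamma>\<^sup>2 * (\<tau> + t * (8 * pi * Re (q * cnj z)) + t\<^sup>2 * n2 + t ^ 3 * n3 + t ^ 4 * n4))"
  have h_nonneg: "h t \<ge> 0" for t
  proof -
    let ?u = "\<lambda>x. \<Phi> x + of_real t * (z * character k x)"
    have u_eq: "?u = (\<lambda>x. \<Phi> x + (of_real t * z) * character k x)" by (simp add: mult.assoc)
    have uH: "?u \<in> H_per s" unfolding u_eq by (intro energy_add_character H s0)
    have "energy s \<omega> ?u = E t"
      unfolding u_eq energy_add_character(2)[OF H s0] \<Phi>(2) E_def \<Gamma>_def c_def
      by (simp add: norm_mult power_mult_distrib algebra_simps)
    then show ?thesis
      using homogeneous_energy_inequality[OF assms(1,3,4) uH] unfolding expand[rule_format] h_def \<Gamma>_def by simp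
  qed
  have h0: "h 0 = 0" by (simp add: h_def E_def)
  have "(h has_real_derivative (\<tau> * (2 * \<Gamma> * (2 * pi * symbol s \<omega> k * Re (c * cnj z))) - \<Gamma>\<^sup>2 * (8 * pi * Re (q * cnj z)))) (at 0)"
    unfolding h_def E_def by (auto intro!: derivative_eq_intros)
  then have "\<tau> * (2 * \<Gamma> * (2 * pi * symbol s \<omega> k * Re (c * cnj z))) - \<Gamma>\<^sup>2 * (8 * pi * Re (q * cnj z)) = 0"
    by (rule DERIV_local_min[of _ _ _ 1]) (use h_nonneg h0 in auto)
  then have "(4 * pi * \<Gamma>) * (\<tau> * symbol s \<omega> k * Re (c * cnj z) - 2 * \<Gamma> * Re (q * cnj z)) = 0"
    by (simp add: power2_eq_square algebra_simps)
  then have "\<tau> * symbol s \<omega> k * Re (c * cnj z) - 2 * \<Gamma> * Re (q * cnj z) = 0"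
    using \<Gamma> by simp
  also have "\<tau> * symbol s \<omega> k * Re (c * cnj z) - 2 * \<Gamma> * Re (q * cnj z) = Re (z * cnj z)"
    unfolding z_def left_diff_distrib minus_complex.sel mult.assoc[of "of_real _"] Re_of_real_mult ..
  also have "\<dots> = (norm z)\<^sup>2" by (simp only: Re_complex_of_real flip: complex_norm_square)
  finally have "z = 0" by simp
  then show ?thesis by (simp add: z_def c_def q_def \<Gamma>_def)
qed

theorem proposition4p2:
  fixes s \<tau> \<omega> :: real
  assumes "1 / 4 < s" and "s \<le> 1" and "\<tau> > 0" and "\<omega> > 0"
  shows "\<exists>\<Phi> \<in> constraint_set s \<tau>.
           energy s \<omega> \<Phi> = min_energy s \<omega> \<tau> \<and>
           min_energy s \<omega> \<tau> > 0 \<and>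
           standing_wave_eq s \<omega> (\<lambda>x. of_real (sqrt (2 * min_energy s \<omega> \<tau> / \<tau>)) * \<Phi> x)"
proof -
  obtain \<Phi> where \<Phi>: "\<Phi> \<in> constraint_set s \<tau>" "energy s \<omega> \<Phi> = min_energy s \<omega> \<tau>"
    using minimizer_exists[OF assms] .
  define \<Gamma> where "\<Gamma> = min_energy s \<omega> \<tau>"
  have \<Gamma>: "\<Gamma> > 0" unfolding \<Gamma>_def by (intro min_energy_pos assms)
  \<comment> \<open>Multiplying by \<open>a\<close> multiplies the cubic term by \<open>a\<^sup>3\<close>, which turns the Lagrange multiplier \<open>a\<^sup>2\<close> into \<open>1\<close>.\<close>
  define a where "a = sqrt (2 * \<Gamma> / \<tau>)"
  have a2: "a\<^sup>2 = 2 * \<Gamma> / \<tau>" using \<Gamma> assms by (simp add: a_def)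
  let ?q = "\<lambda>x. of_real ((norm (\<Phi> x))\<^sup>2) * \<Phi> x"
  have cubic: "(\<lambda>x. of_real ((norm (of_real a * \<Phi> x))\<^sup>2) * (of_real a * \<Phi> x)) = (\<lambda>x. of_real (a * a\<^sup>2) * ?q x)"
    by (auto simp: norm_mult power_mult_distrib)
  have "standing_wave_eq s \<omega> (\<lambda>x. of_real a * \<Phi> x)"
    unfolding standing_wave_eq_def
  proof
    fix k
    have "of_real (symbol s \<omega> k) * fourier_coeff \<Phi> k = of_real (a\<^sup>2) * fourier_coeff ?q k"
      using Euler_Lagrange[OF assms \<Phi>, of k] assms(3) by (simp add: a2 \<Gamma>_def field_simps)
    then have "of_real a * (of_real (symbol s \<omega> k) * fourier_coeff \<Phi> k - of_real (a\<^sup>2) * fourier_coeff ?q k) = 0"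
      by simp
    then show "frac_laplacian_coeff s (\<lambda>x. of_real a * \<Phi> x) k + of_real \<omega> * fourier_coeff (\<lambda>x. of_real a * \<Phi> x) k
      - fourier_coeff (\<lambda>x. of_real ((norm (of_real a * \<Phi> x))\<^sup>2) * (of_real a * \<Phi> x)) k = 0"
      unfolding cubic frac_laplacian_coeff_def fourier_coeff_cmult symbol_def by (simp add: algebra_simps)
  qed
  then show ?thesis using \<Phi> \<Gamma> unfolding a_def \<Gamma>_def by blast
qed

end
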